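(* Let $\mathcal{L}$ be a countable language and let $\mathcal{M}\in\mathrm{Str}(\mathcal{L},\mathbb{N})$ be an $\mathcal{L}$-structure with domain $\mathbb{N}$ such that there is a finite set $B\subset\mathbb{N}$ with $\mathrm{acl}(\bar a,\mathcal{M})\subseteq\{\bar a\}\cup B$ for every finite tuple $\bar a$ in $\mathbb{N}$. Then there is a $\mathrm{Sym}(\mathbb{N})$-quasi-invariant Borel probability measure on $\mathrm{Str}(\mathcal{L},\mathbb{N})$ concentrated on the set of structures isomorphic to $\mathcal{M}$.
   Context: A countable language $\mathcal{L}$ is a countable set of relation and function symbols with finite arities. $\mathrm{Str}(\mathcal{L},\mathbb{N})$ is the Polish space of $\mathcal{L}$-structures with domain $\mathbb{N}$ (identified with $\prod_{R}2^{\mathbb{N}^{n(R)}}\times\prod_{f}\mathbb{N}^{\mathbb{N}^{n(f)}}$), with the logic action of $\mathrm{Sym}(\mathbb{N})$: $g_*\mathcal{M}\models R(\bar a)\iff\mathcal{M}\models R(g^{-1}\bar a)$, $g_*\mathcal{M}\models b=f(\bar a)\iff\mathcal{M}\models g^{-1}b=f(g^{-1}\bar a)$. A Borel measure $\mu$ is $\mathrm{Sym}(\mathbb{N})$-quasi-invariant if $\mu(B)=0\iff\mu(gB)=0$ for all Borel $B$ and $g$. For a tuple $\bar a=(a_0,\dots,a_{n-1})$, $\{\bar a\}=\{a_0,\dots,a_{n-1}\}$ and $\mathrm{acl}(\bar a,\mathcal{M})$ is the set of elements of $\mathbb{N}$ with finite orbit under the pointwise stabilizer $\mathrm{Aut}(\mathcal{M})_{\bar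 a}$. *)

theory Defs
  imports "HOL-Probability.Probability"
begin

text \<open>Symbols are drawn from arbitrary types; the language itself is given by the sets of those
  actually used, so that either set may be empty.\<close>

record ('r, 'f) language =
  rels :: "'r set"
  funs :: "'f set"
  rel_arity :: "'r \<Rightarrow> nat"
  fun_arity :: "'f \<Rightarrow> nat"

definition countable_language :: "('r, 'f) language \<Rightarrow> bool" where
  "countable_language L \<longleftrightarrow> countable (rels L) \<and> countable (funs L)"

definition tuples :: "nat \<Rightarrow> nat list set" where
  "tuples n = {a. length a = n}"

text \<open>A structure with domain \<open>\<nat>\<close> is the pair of its relation and function interpretations. Both
  are extensional (equal to \<^const>\<open>undefined\<close> outside the symbols of the language and outside tuples
  of the right length), so that equality of structures is the intended one.\<close>

type_synonym ('r, 'f) struct = "('r \<Rightarrow> nat list \<Rightarrow> bool) \<times> ('f \<Rightarrow> nat list \<Rightarrow> nat)"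

definition Str :: "('r, 'f) language \<Rightarrow> ('r, 'f) struct set" where
  "Str L = (\<Pi>\<^sub>E R\<in>rels L. tuples (rel_arity L R) \<rightarrow>\<^sub>E UNIV) \<times>
           (\<Pi>\<^sub>E f\<in>funs L. tuples (fun_arity L f) \<rightarrow>\<^sub>E UNIV)"

definition Str_topology :: "('r, 'f) language \<Rightarrow> ('r, 'f) struct topology" where
  "Str_topology L = prod_topology
     (product_topology (\<lambda>R. product_topology (\<lambda>_. discrete_topology UNIV) (tuples (rel_arity L R)))
       (rels L))
     (product_topology (\<lambda>f. product_topology (\<lambda>_. discrete_topology UNIV) (tuples (fun_arity L f)))
       (funs L))"

lemma topspace_Str_topology [simp]: "topspace (Str_topology L) = Str L"
  by (simp add: Str_topology_def Str_def)

definition borel_Str :: "('r, 'f) language \<Rightarrow> ('r, 'f) struct measure" where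
  "borel_Str L = sigma (Str L) {U. openin (Str_topology L) U}"

definition logic_action ::
  "('r, 'f) language \<Rightarrow> (nat \<Rightarrow> nat) \<Rightarrow> ('r, 'f) struct \<Rightarrow> ('r, 'f) struct" where
  "logic_action L g M =
     ((\<lambda>R\<in>rels L. \<lambda>a\<in>tuples (rel_arity L R). fst M R (map (inv g) a)),
      (\<lambda>f\<in>funs L. \<lambda>a\<in>tuples (fun_arity L f). g (snd M f (map (inv g) a))))"

text \<open>The image of a Borel set under the action of a permutation is again Borel, because the
  permutation acts by a homeomorphism; \<^const>\<open>null_sets\<close> is used rather than the equation
  \<open>emeasure \<mu> X = 0\<close>, as the latter holds by convention for non-measurable \<open>X\<close>.\<close>

definition quasi_invariant :: "('r, 'f) language \<Rightarrow> ('r, 'f) struct measure \<Rightarrow> bool" where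
  "quasi_invariant L \<mu> \<longleftrightarrow>
     (\<forall>g. bij g \<longrightarrow> (\<forall>B\<in>sets \<mu>. B \<in> null_sets \<mu> \<longleftrightarrow> logic_action L g ` B \<in> null_sets \<mu>))"

definition isomorphism ::
  "('r, 'f) language \<Rightarrow> (nat \<Rightarrow> nat) \<Rightarrow> ('r, 'f) struct \<Rightarrow> ('r, 'f) struct \<Rightarrow> bool" where
  "isomorphism L h M N \<longleftrightarrow> bij h \<and>
     (\<forall>R\<in>rels L. \<forall>a\<in>tuples (rel_arity L R). fst M R a \<longleftrightarrow> fst N R (map h a)) \<and>
     (\<forall>f\<in>funs L. \<forall>a\<in>tuples (fun_arity L f). h (snd M f a) = snd N f (map h a))"

definition isomorphic :: "('r, 'f) language \<Rightarrow> ('r, 'f) struct \<Rightarrow> ('r, 'f) struct \<Rightarrow> bool" where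
  "isomorphic L M N \<longleftrightarrow> (\<exists>h. isomorphism L h M N)"

definition Aut :: "('r, 'f) language \<Rightarrow> ('r, 'f) struct \<Rightarrow> (nat \<Rightarrow> nat) set" where
  "Aut L M = {g. isomorphism L g M M}"

definition pointwise_stabilizer :: "(nat \<Rightarrow> nat) set \<Rightarrow> nat set \<Rightarrow> (nat \<Rightarrow> nat) set" where
  "pointwise_stabilizer G A = {g \<in> G. \<forall>x\<in>A. g x = x}"

definition acl :: "('r, 'f) language \<Rightarrow> nat list \<Rightarrow> ('r, 'f) struct \<Rightarrow> nat set" where
  "acl L a M = {x. finite ((\<lambda>g. g x) ` pointwise_stabilizer (Aut L M) (set a))}"

end

(*
  Let H be the pointwise stabilizer of B in Aut M. By hypothesis, for every finite A the stabilizer of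
  A in H moves every point outside A and B to infinitely many places. Hence one can grow finite sets
  F_k of labels in N such that each x in F_k has a duplicate in F_(k+1), every way of replacing some
  points of F_k by their duplicates is realised by an element of H, and all types over finite sets of
  labels are eventually realised by new labels.

  Each position i carries an independent random sequence of numbers that drives its label: it waits
  unlabelled, then picks a new label, and later at each stage keeps its label or passes to the
  duplicate. Almost surely any two positions eventually get different labels, and a back-and-forth
  argument turns the labels into a bijection theta of N, well defined up to Aut M on every finite set.
  The pull-back of M along theta depends continuously on the random sequences and its law is
  invariant under permutations of the positions, except that the points of B have to be placed by
  hand, at an injection beta : B -> N. Mixing over all beta with positive weights gives a
  quasi-invariant measure.

  The isomorphism class of M is not shown to be Borel: by inner regularity the law is concentrated on
  a countable union of continuous images of compact sets, which is Borel and consists of copies of M.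
*)

theory Submission imports Defs "HOL-Probability.Discrete_Topology" "HOL-Analysis.Function_Metric" begin

section \<open>Labels and permutation groups\<close>

text \<open>The row \<open>r\<close> of a position drives its label: \<open>r k = 0\<close> means no change at stage \<open>k\<close>; otherwise
  an unlabelled position receives one of the new labels \<open>e k\<close> and a labelled one passes to the
  duplicate \<open>d k\<close> of its label.\<close>

primrec label :: "(nat \<Rightarrow> nat \<Rightarrow> nat) \<Rightarrow> (nat \<Rightarrow> nat \<Rightarrow> nat) \<Rightarrow> (nat \<Rightarrow> nat) \<Rightarrow> nat \<Rightarrow> nat option"
where
  "label d e r 0 = None"
| "label d e r (Suc k) = (case label d e r k of
     None \<Rightarrow> (case r k of 0 \<Rightarrow> None | Suc n \<Rightarrow> Some (e k n))
   | Some x \<Rightarrow> Some (if r k = 0 then x else d k x))"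

lemma label_cong:
  "(\<And>j. j < k \<Longrightarrow> r j = r' j) \<Longrightarrow> label d e r k = label d e r' k"
proof (induction k)
  case (Suc k)
  then have "label d e r k = label d e r' k" "r k = r' k" by simp_all
  then show ?case by (cases "label d e r' k") simp_all
qed simp

lemma label_eq_None: "(\<And>j. j < k \<Longrightarrow> r j = 0) \<Longrightarrow> label d e r k = None"
  by (induction k) simp_all

text \<open>The group used below fixes \<open>B\<close> pointwise, so labels taken from
  \<open>B\<close> can stay constant; \<open>\<beta>\<close> records where the points of
  \<open>B\<close> are placed by hand.\<close>

definition lab ::
  "nat set \<Rightarrow> (nat \<Rightarrow> nat \<Rightarrow> nat) \<Rightarrow> (nat \<Rightarrow> nat \<Rightarrow> nat) \<Rightarrow> (nat \<Rightarrow> nat) \<Rightarrow> (nat \<times> nat \<Rightarrow> nat) \<Rightarrow>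
    nat \<Rightarrow> nat \<Rightarrow> nat option"
where
  "lab B d e \<beta> w k i =
     (if i \<in> \<beta> ` B then Some (inv_into B \<beta> i) else label d e (\<lambda>j. w (i, j)) k)"

definition sep :: "(nat \<Rightarrow> nat option) \<Rightarrow> nat set \<Rightarrow> bool" where
  "sep l S \<longleftrightarrow> (\<forall>i\<in>S. l i \<noteq> None) \<and> inj_on l S"

text \<open>The pairs with \<open>i = j\<close> account for being labelled, so that eventual
  separation of a finite set reduces to pairs.\<close>

lemma sep_iff_pairs: "S \<noteq> {} \<Longrightarrow> sep l S \<longleftrightarrow> (\<forall>i\<in>S. \<forall>j\<in>S. sep l {i, j})"
  by (auto simp: sep_def inj_on_def)

text \<open>The first condition eventually separates any two positions; the second one provides, for
  every label that may ever be created, positions that carry it.\<close>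

definition good :: "(nat \<times> nat \<Rightarrow> nat) set" where
  "good = {w. (\<forall>i j. i \<noteq> j \<longrightarrow> (\<exists>\<^sub>\<infinity>k. w (i, k) = 1 \<and> w (j, k) = 0)) \<and>
              (\<forall>v. \<exists>\<^sub>\<infinity>i. \<forall>k<length v. w (i, k) = v ! k)}"

text \<open>This abstracts from the pointwise stabilizer of \<open>B\<close> in the automorphism
  group. Axiom \<open>infinite_orbit\<close> carries the hypothesis on algebraic closure: no point
  outside \<open>A \<union> B\<close> is algebraic over \<open>A \<union> B\<close>.\<close>

locale stabilizer_group =
  fixes H :: "(nat \<Rightarrow> nat) set" and B :: "nat set"
  assumes finite_B: "finite B"
    and id_in: "id \<in> H"
    and comp_in: "g \<in> H \<Longrightarrow> h \<in> H \<Longrightarrow> g \<circ> h \<in> H"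
    and inv_in: "h \<in> H \<Longrightarrow> inv h \<in> H"
    and bij_in: "h \<in> H \<Longrightarrow> bij h"
    and fixes_B: "h \<in> H \<Longrightarrow> b \<in> B \<Longrightarrow> h b = b"
    and infinite_orbit: "finite A \<Longrightarrow> x \<notin> A \<union> B \<Longrightarrow> infinite {h x |h. h \<in> H \<and> (\<forall>a\<in>A. h a = a)}"
begin

lemma in_B_iff: "h \<in> H \<Longrightarrow> h x \<in> B \<longleftrightarrow> x \<in> B"
  using bij_in fixes_B by (metis bij_pointE)

text \<open>Duplicates are created one point at a time; each new one is obtained from a permutation
  that fixes all earlier points, and \<open>C\<close> holds the points that are still to be duplicated.\<close>

lemma ex_duplicates:
  assumes "finite F" "F \<inter> (B \<union> C) = {}" "finite C"
  shows "\<exists>d. inj_on d F \<and> d ` F \<inter> (F \<union> B \<union> C) = {} \<and>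
    (\<forall>T. \<exists>h\<in>H. (\<forall>x\<in>F. h x = (if x \<in> T then d x else x)) \<and> (\<forall>x\<in>C. h x = x))"
  using assms
proof (induction F arbitrary: C rule: finite_induct)
  case empty
  then show ?case using id_in by (auto intro!: bexI[of _ id])
next
  case (insert y F)
  \<comment> \<open>With \<open>y\<close> among the points kept fixed, the duplicates of
    \<open>F\<close> avoid \<open>y\<close> and the permutations obtained for \<open>F\<close> fix
    \<open>y\<close>.\<close>
  have "F \<inter> (B \<union> insert y C) = {}" using insert by auto
  then obtain d where d: "inj_on d F" "d ` F \<inter> (F \<union> B \<union> insert y C) = {}"
    and dT: "\<And>T. \<exists>h\<in>H. (\<forall>x\<in>F. h x = (if x \<in> T then d x else x)) \<and> (\<forall>x\<in>insert y C. h x = x)"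
    using insert.IH[of "insert y C"] insert.prems by auto
  define A where "A = F \<union> d ` F \<union> C"
  have A: "finite A" "y \<notin> A \<union> B" using insert d by (auto simp: A_def)
  \<comment> \<open>The duplicate of \<open>y\<close> is its image under some \<open>g\<close> that
    fixes all other points in play; an infinite orbit leaves room outside the finite set to be
    avoided.\<close>
  have "infinite ({h y |h. h \<in> H \<and> (\<forall>a\<in>A. h a = a)} - insert y (A \<union> B))"
    by (rule Diff_infinite_finite) (use A finite_B infinite_orbit[OF A] in auto)
  then have "{h y |h. h \<in> H \<and> (\<forall>a\<in>A. h a = a)} - insert y (A \<union> B) \<noteq> {}"
    using infinite_imp_nonempty by blast
  then obtain g where g: "g \<in> H" "\<And>a. a \<in> A \<Longrightarrow> g a = a" "g y \<notin> insert y (A \<union> B)"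
    by blast
  define d' where "d' = d(y := g y)"
  have d'_F: "d' x = d x" if "x \<in> F" for x using that insert by (auto simp: d'_def)
  have d'_y: "d' y = g y" by (simp add: d'_def)
  have im: "d' ` F = d ` F" using d'_F by (rule image_cong[OF refl])
  have "inj_on d' F" using d(1) d'_F by (simp add: inj_on_def)
  then have "inj_on d' (insert y F)" using g(3) im insert.hyps(2) by (simp add: A_def d'_y)
  moreover have "d' ` insert y F \<inter> (insert y F \<union> B \<union> C) = {}"
    using d(2) g(3) unfolding image_insert im d'_y A_def by blast
  moreover have "\<exists>h\<in>H. (\<forall>x\<in>insert y F. h x = (if x \<in> T then d' x else x)) \<and> (\<forall>x\<in>C. h x = x)" for T
  proof -
    obtain h where h: "h \<in> H" "\<And>x. x \<in> F \<Longrightarrow> h x = (if x \<in> T then d x else x)" "\<And>x. x \<in> insert y C \<Longrightarrow> h x = x"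
      using dT by meson
    show ?thesis
    proof (cases "y \<in> T")
      case True
      \<comment> \<open>First \<open>h\<close> sends the chosen points of \<open>F\<close> to their
        duplicates and fixes \<open>y\<close>; then \<open>g\<close> fixes all points of
        \<open>F\<close> and their duplicates and sends \<open>y\<close> to its own
        duplicate.\<close>
      have "(g \<circ> h) x = (if x \<in> T then d' x else x)" if "x \<in> insert y F" for x
        using that h(2)[of x] h(3) g(2) True d'_F[of x] by (cases "x = y") (auto simp: A_def d'_y)
      moreover have "(g \<circ> h) x = x" if "x \<in> C" for x using that h(3) g(2) by (auto simp: A_def)
      ultimately show ?thesis using comp_in[OF g(1) h(1)] by blast
    next
      case False
      then have "h x = (if x \<in> T then d' x else x)" if "x \<in> insert y F" for x
        using that h(2)[of x] h(3) d'_F[of x] by (cases "x = y") auto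
      then show ?thesis using h by blast
    qed
  qed
  ultimately show ?case by blast
qed

text \<open>For \<open>A\<close> below \<open>k\<close> and values in the finite set
  \<open>D\<close>, only finitely many restrictions of members of \<open>H\<close> to
  \<open>A\<close> exist. One representative of each suffices, and \<open>N\<close> collects their
  values at the finitely many \<open>z\<close>.\<close>

lemma ex_realisers:
  assumes "finite D"
  shows "\<exists>N. finite N \<and> N \<noteq> {} \<and> N \<inter> B = {} \<and>
    (\<forall>A z h. A \<subseteq> {..<k} \<longrightarrow> z < k \<longrightarrow> z \<notin> B \<longrightarrow> h \<in> H \<longrightarrow> h ` A \<subseteq> D \<longrightarrow>
       (\<exists>h'\<in>H. (\<forall>x\<in>A. h' x = h x) \<and> h' z \<in> N))"
proof -
  define rep where "rep A r = (SOME h. h \<in> H \<and> restrict h A = r)" for A and r :: "nat \<Rightarrow> nat"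
  define R where "R A = (\<lambda>h. restrict h A) ` {h \<in> H. h ` A \<subseteq> D}" for A
  have rep: "rep A r \<in> H \<and> restrict (rep A r) A = r" if "r \<in> R A" for A r
  proof -
    from that obtain h where "h \<in> H \<and> restrict h A = r" unfolding R_def by blast
    then show ?thesis unfolding rep_def by (rule someI[of "\<lambda>h. h \<in> H \<and> restrict h A = r"])
  qed
  have finite_R: "finite (R A)" if "A \<subseteq> {..<k}" for A
  proof (rule finite_subset)
    show "R A \<subseteq> A \<rightarrow>\<^sub>E D" by (auto simp: R_def)
    show "finite (A \<rightarrow>\<^sub>E D)" using that assms by (meson finite_PiE finite_lessThan finite_subset)
  qed
  \<comment> \<open>The point \<open>b\<close> keeps \<open>N\<close> nonempty, so that it can be
    written as the range of a function.\<close>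
  obtain b where b: "b \<notin> B" using finite_B ex_new_if_finite infinite_UNIV_nat by blast
  define N where "N = insert b (\<Union>A\<in>Pow {..<k}. \<Union>z\<in>{..<k} - B. (\<lambda>r. rep A r z) ` R A)"
  have "finite N" using finite_R by (auto simp: N_def)
  moreover have "N \<inter> B = {}" using b rep by (auto simp: N_def in_B_iff)
  moreover have "\<exists>h'\<in>H. (\<forall>x\<in>A. h' x = h x) \<and> h' z \<in> N"
    if "A \<subseteq> {..<k}" "z < k" "z \<notin> B" "h \<in> H" "h ` A \<subseteq> D" for A z h
  proof -
    have r: "restrict h A \<in> R A" using that by (auto simp: R_def)
    have "rep A (restrict h A) x = h x" if "x \<in> A" for x
      using rep[OF r] that by (metis restrict_apply')
    moreover have "rep A (restrict h A) z \<in> N" using that r unfolding N_def by blast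
    ultimately show ?thesis using rep[OF r] by blast
  qed
  ultimately show ?thesis by (intro exI[of _ N]) (auto simp: N_def)
qed

text \<open>Stage \<open>k\<close> duplicates every old label and then adds realisers over the old
  labels, their duplicates and \<open>B\<close>. The bounds \<open>A \<subseteq> {..<k}\<close> and
  \<open>z < k\<close> keep the additions finite, and every finite \<open>A\<close> and every
  \<open>z\<close> meet them from some stage on.\<close>

lemma ex_tree:
  obtains F :: "nat \<Rightarrow> nat set" and d e :: "nat \<Rightarrow> nat \<Rightarrow> nat" where
    "F 0 = {}"
    "\<And>k. F (Suc k) = F k \<union> d k ` F k \<union> range (e k)"
    "\<And>k. F k \<inter> B = {}"
    "\<And>k. inj_on (d k) (F k)"
    "\<And>k. d k ` F k \<inter> F k = {}"
    "\<And>k T. \<exists>h\<in>H. \<forall>x\<in>F k. h x = (if x \<in> T then d k x else x)"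
    "\<And>k A z h. A \<subseteq> {..<k} \<Longrightarrow> z < k \<Longrightarrow> z \<notin> B \<Longrightarrow> h \<in> H \<Longrightarrow> h ` A \<subseteq> F k \<union> d k ` F k \<union> B \<Longrightarrow>
       \<exists>h'\<in>H. (\<forall>x\<in>A. h' x = h x) \<and> h' z \<in> range (e k)"
proof -
  define isd where "isd F d \<longleftrightarrow> inj_on d F \<and> d ` F \<inter> (F \<union> B) = {} \<and>
    (\<forall>T. \<exists>h\<in>H. \<forall>x\<in>F. h x = (if x \<in> T then d x else x))" for F d
  define ise where "ise k D e \<longleftrightarrow> finite (range e) \<and> range e \<inter> B = {} \<and>
    (\<forall>A z h. A \<subseteq> {..<k} \<longrightarrow> z < k \<longrightarrow> z \<notin> B \<longrightarrow> h \<in> H \<longrightarrow> h ` A \<subseteq> D \<longrightarrow>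
       (\<exists>h'\<in>H. (\<forall>x\<in>A. h' x = h x) \<and> h' z \<in> range e))" for k D and e :: "nat \<Rightarrow> nat"
  have "\<exists>d. isd F d" if "finite F" "F \<inter> B = {}" for F
    using ex_duplicates[of F "{}"] that by (auto simp: isd_def)
  then obtain dd where dd: "\<And>F. finite F \<Longrightarrow> F \<inter> B = {} \<Longrightarrow> isd F (dd F)" by metis
  have "\<exists>e. ise k D e" if D: "finite D" for k D
  proof -
    obtain N where N: "finite N" "N \<noteq> {}" "N \<inter> B = {}"
      "\<forall>A z h. A \<subseteq> {..<k} \<longrightarrow> z < k \<longrightarrow> z \<notin> B \<longrightarrow> h \<in> H \<longrightarrow> h ` A \<subseteq> D \<longrightarrow>
         (\<exists>h'\<in>H. (\<forall>x\<in>A. h' x = h x) \<and> h' z \<in> N)"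
      using ex_realisers[OF D, of k] by blast
    have "range (from_nat_into N) = N"
      using N by (simp add: range_from_nat_into countable_finite)
    then show ?thesis using N by (intro exI[of _ "from_nat_into N"]) (simp add: ise_def)
  qed
  then have "\<forall>k D. \<exists>e. finite D \<longrightarrow> ise k D e" by blast
  then obtain ee where ee: "\<And>k D. finite D \<Longrightarrow> ise k D (ee k D)" by metis
  \<comment> \<open>The choice functions \<open>dd\<close> and \<open>ee\<close> are total, so the
    recursion can be written down first; that they meet their specifications follows once
    \<open>FB\<close> shows the sets to be finite and disjoint from \<open>B\<close>.\<close>
  define F where "F = rec_nat {} (\<lambda>k F. F \<union> dd F ` F \<union> range (ee k (F \<union> dd F ` F \<union> B)))"
  define d where "d k = dd (F k)" for k
  define e where "e k = ee k (F k \<union> d k ` F k \<union> B)" for k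
  have F: "F 0 = {}" "F (Suc k) = F k \<union> d k ` F k \<union> range (e k)" for k
    by (simp_all add: F_def d_def e_def)
  have FB: "finite (F k) \<and> F k \<inter> B = {}" for k
  proof (induction k)
    case (Suc k)
    then have "isd (F k) (d k)" by (simp add: dd d_def)
    moreover have "ise k (F k \<union> d k ` F k \<union> B) (e k)"
      unfolding e_def by (rule ee) (use Suc finite_B in auto)
    ultimately show ?case using Suc by (auto simp: F isd_def ise_def)
  qed (simp add: F)
  have d: "isd (F k) (d k)" for k using FB by (simp add: dd d_def)
  have e: "ise k (F k \<union> d k ` F k \<union> B) (e k)" for k
    unfolding e_def by (rule ee) (use FB finite_B in auto)
  show thesis
  proof (rule that[of F d e])
    fix k
    show "d k ` F k \<inter> F k = {}" using d[of k] unfolding isd_def by blast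
    show "\<exists>h'\<in>H. (\<forall>x\<in>A. h' x = h x) \<and> h' z \<in> range (e k)"
      if "A \<subseteq> {..<k}" "z < k" "z \<notin> B" "h \<in> H" "h ` A \<subseteq> F k \<union> d k ` F k \<union> B" for A z h
      using e[of k] that unfolding ise_def by blast
  qed (use F FB d in \<open>simp_all add: isd_def\<close>)
qed

end

section \<open>Separation of positions by their labels\<close>

locale label_tree = stabilizer_group +
  fixes F :: "nat \<Rightarrow> nat set" and d e :: "nat \<Rightarrow> nat \<Rightarrow> nat"
  assumes F_0: "F 0 = {}"
    and F_Suc: "F (Suc k) = F k \<union> d k ` F k \<union> range (e k)"
    and F_B: "F k \<inter> B = {}"
    and inj_d: "inj_on (d k) (F k)"
    and d_F: "d k ` F k \<inter> F k = {}"
    and duplicates: "\<exists>h\<in>H. \<forall>x\<in>F k. h x = (if x \<in> T then d k x else x)"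
    and realisers: "A \<subseteq> {..<k} \<Longrightarrow> z < k \<Longrightarrow> z \<notin> B \<Longrightarrow> h \<in> H \<Longrightarrow> h ` A \<subseteq> F k \<union> d k ` F k \<union> B \<Longrightarrow>
       \<exists>h'\<in>H. (\<forall>x\<in>A. h' x = h x) \<and> h' z \<in> range (e k)"
begin

abbreviation row_label :: "(nat \<Rightarrow> nat) \<Rightarrow> (nat \<times> nat \<Rightarrow> nat) \<Rightarrow> nat \<Rightarrow> nat \<Rightarrow> nat option" where
  "row_label \<equiv> lab B d e"

lemma label_in_F: "label d e r k = Some x \<Longrightarrow> x \<in> F k"
  by (induction k arbitrary: x) (auto simp: F_0 F_Suc split: option.splits nat.splits if_splits)

text \<open>A position already labelled at stage \<open>k\<close> only keeps or duplicates its
  label, which gives the range condition of \<open>realisers\<close>.\<close>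

lemma row_label_Suc_in:
  assumes "inj_on \<beta> B" "row_label \<beta> w k i = Some y" "row_label \<beta> w (Suc k) i = Some x"
  shows "x \<in> F k \<union> d k ` F k \<union> B"
proof (cases "i \<in> \<beta> ` B")
  case True
  then show ?thesis using assms by (auto simp: lab_def)
next
  case False
  then have "y \<in> F k" "x = y \<or> x = d k y"
    using assms label_in_F by (auto simp: lab_def split: if_splits)
  then show ?thesis by blast
qed

lemma row_label_in_B: "inj_on \<beta> B \<Longrightarrow> b \<in> B \<Longrightarrow> row_label \<beta> w k (\<beta> b) = Some b"
  by (simp add: lab_def)

lemma sep_related:
  assumes "sep l S" "h \<in> H" "\<And>i. i \<in> S \<Longrightarrow> l' i = map_option h (l i)"
  shows "sep l' S"
proof -
  have "inj (map_option h)" using bij_in[OF assms(2)] by (simp add: bij_def option.inj_map)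
  then show ?thesis using assms by (auto simp: sep_def inj_on_def)
qed

text \<open>On a separated set a label determines its position, so choosing the positions that
  change amounts to choosing a set \<open>T\<close> of labels, and \<open>duplicates\<close>
  realises that choice by one member of \<open>H\<close>.\<close>

lemma row_label_Suc:
  assumes \<beta>: "inj_on \<beta> B" and S: "sep (row_label \<beta> w k) S"
  shows "\<exists>h\<in>H. \<forall>i\<in>S. row_label \<beta> w (Suc k) i = map_option h (row_label \<beta> w k i)"
proof -
  define T where "T = {x. \<exists>i\<in>S - \<beta> ` B. w (i, k) \<noteq> 0 \<and> row_label \<beta> w k i = Some x}"
  obtain h where h: "h \<in> H" "\<forall>x\<in>F k. h x = (if x \<in> T then d k x else x)"
    using duplicates by blast
  have "row_label \<beta> w (Suc k) i = map_option h (row_label \<beta> w k i)" if i: "i \<in> S" for i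
  proof (cases "i \<in> \<beta> ` B")
    case True
    then show ?thesis using h(1) \<beta> by (auto simp: lab_def fixes_B)
  next
    case False
    obtain x where x: "row_label \<beta> w k i = Some x" using S i by (auto simp: sep_def)
    have xF: "x \<in> F k" using x False label_in_F by (auto simp: lab_def)
    have "x \<in> T \<longleftrightarrow> w (i, k) \<noteq> 0"
    proof
      assume "x \<in> T"
      then obtain j where "j \<in> S" "w (j, k) \<noteq> 0" "row_label \<beta> w k j = Some x"
        by (auto simp: T_def)
      then show "w (i, k) \<noteq> 0" using S i x by (metis inj_onD sep_def)
    qed (use i False x in \<open>auto simp: T_def\<close>)
    then show ?thesis using x xF False h(2) by (auto simp: lab_def)
  qed
  then show ?thesis using h(1) by blast
qed

text \<open>Members of \<open>H\<close> are injective, so separation passes from each stage to the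
  next and the one-step permutations compose.\<close>

lemma row_label_le:
  assumes \<beta>: "inj_on \<beta> B" and S: "sep (row_label \<beta> w k) S" and "k \<le> k'"
  shows "\<exists>h\<in>H. \<forall>i\<in>S. row_label \<beta> w k' i = map_option h (row_label \<beta> w k i)"
  using \<open>k \<le> k'\<close>
proof (induction k' rule: dec_induct)
  case base
  show ?case by (rule bexI[OF _ id_in]) (simp add: option.map_ident)
next
  case (step n)
  obtain h where h: "h \<in> H" "\<And>i. i \<in> S \<Longrightarrow> row_label \<beta> w n i = map_option h (row_label \<beta> w k i)"
    using step.IH by metis
  have "sep (row_label \<beta> w n) S" by (rule sep_related[OF S h])
  from row_label_Suc[OF \<beta> this] obtain g where g: "g \<in> H"
    "\<And>i. i \<in> S \<Longrightarrow> row_label \<beta> w (Suc n) i = map_option g (row_label \<beta> w n i)" by blast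
  show ?case
    by (rule bexI[OF _ comp_in[OF g(1) h(1)]]) (simp add: g(2) h(2) option.map_comp comp_def)
qed

lemma sep_le:
  assumes "inj_on \<beta> B" "sep (row_label \<beta> w k) S" "k \<le> k'"
  shows "sep (row_label \<beta> w k') S"
proof -
  obtain h where "h \<in> H" "\<And>i. i \<in> S \<Longrightarrow> row_label \<beta> w k' i = map_option h (row_label \<beta> w k i)"
    using row_label_le[OF assms] by metis
  then show ?thesis by (rule sep_related[OF assms(2)])
qed

lemma row_label_related:
  assumes \<beta>: "inj_on \<beta> B" and S: "sep (row_label \<beta> w k) S" "sep (row_label \<beta> w k') S"
  shows "\<exists>h\<in>H. \<forall>i\<in>S. row_label \<beta> w k' i = map_option h (row_label \<beta> w k i)"
proof (cases "k \<le> k'")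
  case True
  then show ?thesis using row_label_le[OF \<beta> S(1)] by blast
next
  case False
  then obtain h where h: "h \<in> H" "\<And>i. i \<in> S \<Longrightarrow> row_label \<beta> w k i = map_option h (row_label \<beta> w k' i)"
    using row_label_le[OF \<beta> S(2), of k] by auto
  have "inv h \<circ> h = id" using bij_in[OF h(1)] by (simp add: bij_def)
  then have "row_label \<beta> w k' i = map_option (inv h) (row_label \<beta> w k i)" if "i \<in> S" for i
    unfolding h(2)[OF that] by (simp add: option.map_comp option.map_id)
  then show ?thesis using inv_in[OF h(1)] by blast
qed

text \<open>Both positions eventually have labels. If these coincide, neither position was placed by
  hand; then \<open>good\<close> gives a later stage at which \<open>i\<close> changes and
  \<open>j\<close> does not, and the duplicate falls outside \<open>F k\<close>, where the label of
  \<open>j\<close> still lies. Separation persists afterwards.\<close>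

lemma eventually_sep_pair:
  assumes \<beta>: "inj_on \<beta> B" and w: "w \<in> good"
  shows "\<forall>\<^sub>F k in sequentially. sep (row_label \<beta> w k) {i, j}"
proof -
  have labelled: "\<exists>k. sep (row_label \<beta> w k) {i}" for i
  proof (cases "i \<in> \<beta> ` B")
    case False
    \<comment> \<open>The position \<open>Suc i\<close> is only a partner for the first condition in
      \<open>good\<close>, which then yields a nonzero entry in row \<open>i\<close>.\<close>
    have "i \<noteq> Suc i" by simp
    then have "\<exists>\<^sub>\<infinity>k. w (i, k) = 1 \<and> w (Suc i, k) = 0" using w unfolding good_def by blast
    then obtain k where "w (i, k) = 1" using INFM_EX by blast
    then have "sep (row_label \<beta> w (Suc k)) {i}"
      using False by (auto simp: sep_def lab_def split: option.splits)
    then show ?thesis by blast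
  qed (auto simp: sep_def lab_def)
  obtain k1 k2 where k12: "sep (row_label \<beta> w k1) {i}" "sep (row_label \<beta> w k2) {j}"
    using labelled by blast
  define m where "m = max k1 k2"
  have m: "row_label \<beta> w k i \<noteq> None" "row_label \<beta> w k j \<noteq> None" if "k \<ge> m" for k
    using sep_le[OF \<beta> k12(1), of k] sep_le[OF \<beta> k12(2), of k] that by (auto simp: sep_def m_def)
  have "\<exists>k. sep (row_label \<beta> w k) {i, j}"
  proof (cases "i = j \<or> row_label \<beta> w m i \<noteq> row_label \<beta> w m j")
    case True
    then show ?thesis using m[of m] by (intro exI[of _ m], auto simp: sep_def)
  next
    case False
    \<comment> \<open>Otherwise the common label would lie both in \<open>B\<close> and in
      \<open>F m\<close>, or be one point of \<open>B\<close> placed at two positions.\<close>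
    have out: "i \<notin> \<beta> ` B \<and> j \<notin> \<beta> ` B"
    proof (rule ccontr)
      assume "\<not> ?thesis"
      moreover have "label d e r m \<noteq> Some (inv_into B \<beta> p)" if "p \<in> \<beta> ` B" for r p
        using label_in_F[of r m] F_B[of m] inv_into_into[OF that] by blast
      moreover have "inv_into B \<beta> i \<noteq> inv_into B \<beta> j" if "i \<in> \<beta> ` B" "j \<in> \<beta> ` B"
        using False that by (meson inv_into_injective)
      ultimately show False using False unfolding lab_def by (metis option.inject)
    qed
    have "\<exists>\<^sub>\<infinity>k. w (i, k) = 1 \<and> w (j, k) = 0" using w False unfolding good_def by blast
    then obtain k where k: "k > m" "w (i, k) = 1" "w (j, k) = 0" unfolding INFM_nat by blast
    obtain x y where xy: "row_label \<beta> w k i = Some x" "row_label \<beta> w k j = Some y"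
      using m[of k] k(1) by fastforce
    have "x \<in> F k" "y \<in> F k" using xy out label_in_F by (auto simp: lab_def)
    moreover have "row_label \<beta> w (Suc k) i = Some (d k x)" "row_label \<beta> w (Suc k) j = Some y"
      using k xy out by (auto simp: lab_def)
    ultimately have "sep (row_label \<beta> w (Suc k)) {i, j}"
      using d_F[of k] by (auto simp: sep_def inj_on_def)
    then show ?thesis by blast
  qed
  then show ?thesis unfolding eventually_sequentially using sep_le[OF \<beta>] by blast
qed

lemma eventually_sep:
  assumes \<beta>: "inj_on \<beta> B" and w: "w \<in> good" and S: "finite S"
  shows "\<forall>\<^sub>F k in sequentially. sep (row_label \<beta> w k) S"
proof (cases "S = {}")
  case False
  then show ?thesis
    by (subst sep_iff_pairs)
      (auto intro!: eventually_ball_finite S eventually_sep_pair[OF \<beta> w])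
qed (simp add: sep_def)

section \<open>Back and forth\<close>

text \<open>Partial maps are compared with labels only up to \<open>H\<close>, because labels of
  separated positions change over time by members of \<open>H\<close>. For injective
  \<open>\<theta>\<close> the stage may be any that separates \<open>S\<close>, as
  \<open>approx_at\<close> shows.\<close>

definition approx :: "(nat \<Rightarrow> nat) \<Rightarrow> (nat \<times> nat \<Rightarrow> nat) \<Rightarrow> nat set \<Rightarrow> (nat \<Rightarrow> nat) \<Rightarrow> bool" where
  "approx \<beta> w S \<theta> \<longleftrightarrow> (\<exists>k. \<exists>h\<in>H. \<forall>i\<in>S. map_option h (row_label \<beta> w k i) = Some (\<theta> i))"

lemma sep_if_inj:
  assumes "inj_on \<theta> S" "\<And>i. i \<in> S \<Longrightarrow> map_option h (row_label \<beta> w k i) = Some (\<theta> i)"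
  shows "sep (row_label \<beta> w k) S"
proof -
  have "row_label \<beta> w k i \<noteq> None" if "i \<in> S" for i using assms(2)[OF that] by auto
  moreover have "inj_on (row_label \<beta> w k) S"
    using assms by (metis (no_types, lifting) inj_on_def option.inject)
  ultimately show ?thesis by (simp add: sep_def)
qed

lemma inj_if_sep:
  assumes "sep (row_label \<beta> w k) S" "h \<in> H"
    and "\<And>i. i \<in> S \<Longrightarrow> map_option h (row_label \<beta> w k i) = Some (\<theta> i)"
  shows "inj_on \<theta> S"
proof -
  have "sep (\<lambda>i. Some (\<theta> i)) S"
    by (rule sep_related[OF assms(1,2)]) (simp add: assms(3))
  then show ?thesis by (simp add: sep_def inj_on_def)
qed

text \<open>Injectivity of \<open>\<theta>\<close> forces the witnessing stage to separate
  \<open>S\<close> as well, so \<open>row_label_related\<close> links the two stages by a member of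
  \<open>H\<close>.\<close>

lemma approx_at:
  assumes \<beta>: "inj_on \<beta> B" and S: "sep (row_label \<beta> w k) S"
    and \<theta>: "approx \<beta> w S \<theta>" "inj_on \<theta> S"
  shows "\<exists>h\<in>H. \<forall>i\<in>S. map_option h (row_label \<beta> w k i) = Some (\<theta> i)"
proof -
  obtain k' h where h: "h \<in> H" "\<And>i. i \<in> S \<Longrightarrow> map_option h (row_label \<beta> w k' i) = Some (\<theta> i)"
    using \<theta>(1) unfolding approx_def by metis
  obtain g where g: "g \<in> H" "\<And>i. i \<in> S \<Longrightarrow> row_label \<beta> w k' i = map_option g (row_label \<beta> w k i)"
    using row_label_related[OF \<beta> S sep_if_inj[OF \<theta>(2) h(2)]] by metis
  have "map_option (h \<circ> g) (row_label \<beta> w k i) = Some (\<theta> i)" if "i \<in> S" for i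
    using h(2)[OF that] g(2)[OF that] by (simp add: option.map_comp)
  then show ?thesis using comp_in[OF h(1) g(1)] by blast
qed

text \<open>At a stage separating \<open>insert i S\<close>, the permutation that carries the labels
  on \<open>S\<close> to \<open>\<theta>\<close> is applied to the label of
  \<open>i\<close>.\<close>

lemma approx_forth:
  assumes \<beta>: "inj_on \<beta> B" and w: "w \<in> good"
    and S: "finite S" "approx \<beta> w S \<theta>" "inj_on \<theta> S" "i \<notin> S"
  shows "\<exists>x. approx \<beta> w (insert i S) (\<theta>(i := x)) \<and> inj_on (\<theta>(i := x)) (insert i S)"
proof -
  have "finite (insert i S)" using S by simp
  from eventually_happens'[OF _ eventually_sep[OF \<beta> w this]]
  obtain k where k: "sep (row_label \<beta> w k) (insert i S)" by auto
  then have "sep (row_label \<beta> w k) S" by (auto simp: sep_def inj_on_def)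
  from approx_at[OF \<beta> this S(2,3)] obtain h where
    h: "h \<in> H" "\<And>j. j \<in> S \<Longrightarrow> map_option h (row_label \<beta> w k j) = Some (\<theta> j)" by metis
  obtain y where y: "row_label \<beta> w k i = Some y" using k by (auto simp: sep_def)
  have *: "map_option h (row_label \<beta> w k j) = Some ((\<theta>(i := h y)) j)" if "j \<in> insert i S" for j
    using that y h(2) S(4) by auto
  show ?thesis
    using inj_if_sep[OF k h(1) *] h(1) * unfolding approx_def by blast
qed

text \<open>The point \<open>z\<close> is pulled back to \<open>z'\<close>, next to the labels
  \<open>A\<close> of \<open>S\<close> at stage \<open>k\<close>. After a late stage
  \<open>m\<close> these labels have become their images under \<open>g\<close>, and
  \<open>realisers\<close> gives \<open>h'\<close> that agrees with \<open>g\<close> on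
  \<open>A\<close> and sends \<open>z'\<close> to a new label. Some position outside
  \<open>S\<close> receives just this label, and \<open>h \<circ> inv h'\<close> carries it to
  \<open>z\<close>.\<close>

lemma approx_back:
  assumes \<beta>: "inj_on \<beta> B" and w: "w \<in> good"
    and S: "finite S" "\<beta> ` B \<subseteq> S" "approx \<beta> w S \<theta>" "inj_on \<theta> S" "z \<notin> \<theta> ` S"
  shows "\<exists>i. i \<notin> S \<and> approx \<beta> w (insert i S) (\<theta>(i := z))"
proof -
  obtain k h where h: "h \<in> H" "\<And>i. i \<in> S \<Longrightarrow> map_option h (row_label \<beta> w k i) = Some (\<theta> i)"
    using S(3) unfolding approx_def by metis
  have sep_k: "sep (row_label \<beta> w k) S" by (rule sep_if_inj[OF S(4) h(2)])
  \<comment> \<open>A point of \<open>B\<close> is already a value of \<open>\<theta>\<close>, at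
    the position where \<open>\<beta>\<close> placed it.\<close>
  have "z \<notin> B"
  proof
    assume "z \<in> B"
    then have "\<theta> (\<beta> z) = z" "\<beta> z \<in> S"
      using h(2)[of "\<beta> z"] S(2) row_label_in_B[OF \<beta>] fixes_B[OF h(1)] by auto
    then show False using S(5) by (metis imageI)
  qed
  define z' where "z' = inv h z"
  have z': "h z' = z" "z' \<notin> B"
    using bij_in[OF h(1)] in_B_iff[OF inv_in[OF h(1)]] \<open>z \<notin> B\<close>
    by (auto simp: z'_def bij_def surj_f_inv_f)
  define A where "A = (\<lambda>i. the (row_label \<beta> w k i)) ` S"
  have A: "row_label \<beta> w k i = Some (the (row_label \<beta> w k i))" "the (row_label \<beta> w k i) \<in> A"
    if "i \<in> S" for i using that sep_k by (auto simp: sep_def A_def)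
  \<comment> \<open>The successor of the maximum puts \<open>A\<close> and \<open>z'\<close>
    strictly below \<open>m\<close>, as \<open>realisers\<close> demands, and stage \<open>k\<close>
    before \<open>m\<close>.\<close>
  define m where "m = Suc (Max (insert k (insert z' A)))"
  have fin: "finite (insert k (insert z' A))" using S(1) by (simp add: A_def)
  have m: "k \<le> Suc m" "z' < m" "A \<subseteq> {..<m}" "k \<le> m"
    using Max_ge[OF fin] by (auto simp: m_def less_Suc_eq_le intro: le_SucI)
  obtain g where g: "g \<in> H"
    "\<And>i. i \<in> S \<Longrightarrow> row_label \<beta> w (Suc m) i = map_option g (row_label \<beta> w k i)"
    using row_label_le[OF \<beta> sep_k m(1)] by metis
  have "g ` A \<subseteq> F m \<union> d m ` F m \<union> B"
  proof
    fix x assume "x \<in> g ` A"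
    then obtain i where i: "i \<in> S" "x = g (the (row_label \<beta> w k i))" by (auto simp: A_def)
    have "row_label \<beta> w (Suc m) i = Some x"
      using g(2)[OF i(1)] A(1)[OF i(1)] i(2) by (metis option.map(2))
    moreover obtain y where "row_label \<beta> w m i = Some y"
      using sep_le[OF \<beta> sep_k m(4)] i(1) by (auto simp: sep_def)
    ultimately show "x \<in> F m \<union> d m ` F m \<union> B" using row_label_Suc_in[OF \<beta>] by blast
  qed
  then obtain h' where h': "h' \<in> H" "\<And>x. x \<in> A \<Longrightarrow> h' x = g x" "h' z' \<in> range (e m)"
    using realisers[OF m(3,2) z'(2) g(1)] by blast
  then obtain n where n: "h' z' = e m n" by blast
  \<comment> \<open>The \<open>m\<close> zeros keep the position unlabelled until stage
    \<open>m\<close>; the last entry is \<open>Suc n\<close> because \<open>0\<close> stands for no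
    change. Infinitely many positions have this pattern, so one avoids the finite set
    \<open>S\<close>.\<close>
  define v where "v = replicate m 0 @ [Suc n]"
  have "\<exists>\<^sub>\<infinity>i. \<forall>j<length v. w (i, j) = v ! j" using w by (simp add: good_def)
  then have "infinite {i. \<forall>j<length v. w (i, j) = v ! j}" by (simp add: frequently_cofinite)
  then have "\<not> {i. \<forall>j<length v. w (i, j) = v ! j} \<subseteq> S" using S(1) finite_subset by blast
  then obtain i where i: "i \<notin> S" "\<And>j. j < length v \<Longrightarrow> w (i, j) = v ! j" by blast
  have "w (i, m) = Suc n" "\<And>j. j < m \<Longrightarrow> w (i, j) = 0"
    using i(2) by (auto simp: v_def nth_append)
  then have "label d e (\<lambda>j. w (i, j)) (Suc m) = Some (e m n)"
    using label_eq_None[of m "\<lambda>j. w (i, j)" d e] by simp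
  then have lab_i: "row_label \<beta> w (Suc m) i = Some (h' z')"
    using i(1) S(2) n by (auto simp: lab_def)
  have "inv h' (h' x) = x" for x using bij_in[OF h'(1)] by (simp add: bij_def)
  then have *: "(h \<circ> inv h') (h' x) = h x" for x by simp
  have "map_option (h \<circ> inv h') (row_label \<beta> w (Suc m) j) = Some ((\<theta>(i := z)) j)"
    if "j \<in> insert i S" for j
  proof (cases "j = i")
    case True
    then show ?thesis using lab_i * z'(1) by simp
  next
    case False
    then have j: "j \<in> S" using that by blast
    define y where "y = the (row_label \<beta> w k j)"
    have y: "row_label \<beta> w k j = Some y" "y \<in> A" using A[OF j] by (simp_all add: y_def)
    have "row_label \<beta> w (Suc m) j = Some (h' y)" using g(2)[OF j] y h'(2) by simp
    moreover have "h y = \<theta> j" using h(2)[OF j] y(1) by simp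
    ultimately show ?thesis using * False by simp
  qed
  then show ?thesis
    using i(1) comp_in[OF h(1) inv_in[OF h'(1)]] unfolding approx_def by blast
qed

section \<open>Bijections compatible with the labels\<close>

definition compat :: "(nat \<Rightarrow> nat) \<Rightarrow> (nat \<times> nat \<Rightarrow> nat) \<Rightarrow> (nat \<Rightarrow> nat) \<Rightarrow> bool" where
  "compat \<beta> w \<theta> \<longleftrightarrow> bij \<theta> \<and> (\<forall>S. finite S \<longrightarrow> approx \<beta> w S \<theta>)"

lemma approx_mono: "approx \<beta> w S \<theta> \<Longrightarrow> T \<subseteq> S \<Longrightarrow> approx \<beta> w T \<theta>"
  unfolding approx_def by blast

lemma approx_cong: "(\<And>i. i \<in> S \<Longrightarrow> \<theta> i = \<theta>' i) \<Longrightarrow> approx \<beta> w S \<theta> \<longleftrightarrow> approx \<beta> w S \<theta>'"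
  unfolding approx_def by simp

text \<open>Step \<open>n\<close> of the construction puts \<open>n\<close> first into the domain,
  by \<open>approx_forth\<close>, and then into the range, by \<open>approx_back\<close>. The union
  of the partial maps is a bijection.\<close>

lemma ex_compat:
  assumes \<beta>: "inj_on \<beta> B" and w: "w \<in> good"
  shows "\<exists>\<theta>. compat \<beta> w \<theta>"
proof -
  define P where "P n s \<longleftrightarrow> finite (fst s) \<and> \<beta> ` B \<subseteq> fst s \<and> approx \<beta> w (fst s) (snd s) \<and> inj_on (snd s) (fst s)"
    for n :: nat and s
  define Q where "Q n s t \<longleftrightarrow> fst s \<subseteq> fst t \<and> (\<forall>i\<in>fst s. snd t i = snd s i) \<and> n \<in> fst t \<and> n \<in> snd t ` fst t"
    for n s and t :: "nat set \<times> (nat \<Rightarrow> nat)"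
  have "\<exists>f. \<forall>n. P n (f n) \<and> Q n (f n) (f (Suc n))"
  proof (rule dependent_nat_choice)
    \<comment> \<open>The start places \<open>B\<close>, so that every later domain contains the
      positions that \<open>approx_back\<close> asks for.\<close>
    have "map_option id (row_label \<beta> w 0 i) = Some (inv_into B \<beta> i)" if "i \<in> \<beta> ` B" for i
      using that by (simp add: lab_def)
    then have "approx \<beta> w (\<beta> ` B) (inv_into B \<beta>)" unfolding approx_def using id_in by blast
    then show "\<exists>s. P 0 s"
      using finite_B by (intro exI[of _ "(\<beta> ` B, inv_into B \<beta>)"]) (simp add: P_def inj_on_inv_into)
  next
    fix s n assume "P n s"
    then obtain S \<theta> where s: "s = (S, \<theta>)" and S: "finite S" "\<beta> ` B \<subseteq> S" "approx \<beta> w S \<theta>" "inj_on \<theta> S"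
      by (cases s) (auto simp: P_def)
    obtain S' \<theta>' where S': "finite S'" "\<beta> ` B \<subseteq> S'" "approx \<beta> w S' \<theta>'" "inj_on \<theta>' S'"
      and ext: "S \<subseteq> S'" "\<forall>i\<in>S. \<theta>' i = \<theta> i" "n \<in> S'"
    proof (cases "n \<in> S")
      case False
      obtain x where "approx \<beta> w (insert n S) (\<theta>(n := x))" "inj_on (\<theta>(n := x)) (insert n S)"
        using approx_forth[OF \<beta> w S(1,3,4) False] by blast
      then show thesis using S False by (intro that[of "insert n S" "\<theta>(n := x)"]) auto
    qed (use S in \<open>auto intro: that[of S \<theta>]\<close>)
    show "\<exists>t. P (Suc n) t \<and> Q n s t"
    proof (cases "n \<in> \<theta>' ` S'")
      case True
      then show ?thesis using S' ext by (intro exI[of _ "(S', \<theta>')"]) (simp add: P_def Q_def s)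
    next
      case False
      obtain i where i: "i \<notin> S'" "approx \<beta> w (insert i S') (\<theta>'(i := n))"
        using approx_back[OF \<beta> w S' False] by blast
      have "inj_on (\<theta>'(i := n)) (insert i S')"
        using S'(4) False i(1) by (auto simp: inj_on_def)
      moreover have "\<forall>j\<in>S. (\<theta>'(i := n)) j = \<theta> j" using ext i(1) by auto
      ultimately show ?thesis using S' ext i
        by (intro exI[of _ "(insert i S', \<theta>'(i := n))"]) (auto simp: P_def Q_def s)
    qed
  qed
  then obtain f where P: "P n (f n)" and Q: "Q n (f n) (f (Suc n))" for n by metis
  have mono: "fst (f m) \<subseteq> fst (f n) \<and> (\<forall>i\<in>fst (f m). snd (f n) i = snd (f m) i)" if "m \<le> n" for m n
    using that
  proof (induction n rule: dec_induct)
    case (step n)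
    then show ?case using Q[of n] unfolding Q_def by (metis subset_iff)
  qed simp
  \<comment> \<open>By step \<open>i\<close> of the chain, \<open>i\<close> lies in the domain of
    the map numbered \<open>Suc i\<close>, and later maps extend that one.\<close>
  define \<theta> where "\<theta> i = snd (f (Suc i)) i" for i
  have mem: "i \<in> fst (f (Suc i))" for i using Q[of i] by (simp add: Q_def)
  have \<theta>: "\<theta> i = snd (f n) i" if "i \<in> fst (f n)" for i n
  proof (cases "n \<le> Suc i")
    case True
    then show ?thesis using mono[OF True] that unfolding \<theta>_def by blast
  next
    case False
    then have "Suc i \<le> n" by simp
    then show ?thesis using mono[of "Suc i" n] mem[of i] unfolding \<theta>_def by force
  qed
  have cover: "\<exists>n. S \<subseteq> fst (f n)" if "finite S" for S
  proof -
    obtain N where "S \<subseteq> {..N}" using \<open>finite S\<close> finite_nat_iff_bounded_le by auto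
    moreover have "i \<in> fst (f (Suc N))" if "i \<le> N" for i
      using mono[of "Suc i" "Suc N"] mem[of i] that by blast
    ultimately have "S \<subseteq> fst (f (Suc N))" by blast
    then show ?thesis by blast
  qed
  have "inj \<theta>"
  proof (rule injI)
    fix i j assume eq: "\<theta> i = \<theta> j"
    obtain n where n: "{i, j} \<subseteq> fst (f n)" using cover[of "{i, j}"] by auto
    then have "snd (f n) i = snd (f n) j" using eq \<theta>[of i n] \<theta>[of j n] by simp
    then show "i = j" using P[of n] n unfolding P_def by (auto dest: inj_onD)
  qed
  moreover have "surj \<theta>"
    unfolding surj_def
  proof
    fix z
    obtain i where "i \<in> fst (f (Suc z))" "z = snd (f (Suc z)) i" using Q[of z] unfolding Q_def by blast
    then show "\<exists>i. z = \<theta> i" using \<theta> by metis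
  qed
  moreover have "approx \<beta> w S \<theta>" if "finite S" for S
  proof -
    obtain n where n: "S \<subseteq> fst (f n)" using cover[OF \<open>finite S\<close>] by blast
    have "approx \<beta> w (fst (f n)) \<theta>"
      using P[of n] \<theta> approx_cong[of "fst (f n)" \<theta> "snd (f n)"] by (simp add: P_def)
    then show ?thesis using n by (rule approx_mono)
  qed
  ultimately show ?thesis unfolding compat_def bij_def by blast
qed

lemma compat_on_B:
  assumes "inj_on \<beta> B" "compat \<beta> w \<theta>" "b \<in> B"
  shows "\<theta> (\<beta> b) = b"
proof -
  have "approx \<beta> w {\<beta> b} \<theta>" using assms(2) unfolding compat_def by simp
  then obtain k h where "h \<in> H" "map_option h (row_label \<beta> w k (\<beta> b)) = Some (\<theta> (\<beta> b))"
    unfolding approx_def by blast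
  then show ?thesis using row_label_in_B[OF assms(1,3)] fixes_B[OF \<open>h \<in> H\<close> assms(3)] by simp
qed

text \<open>The labels on \<open>S\<close> at stage \<open>k\<close> depend only on the first
  \<open>k\<close> entries of the rows in \<open>S\<close>. Where these agree, both maps are copies
  of the same labels and differ by \<open>h' \<circ> inv h\<close>. The case \<open>w' = w\<close>
  is uniqueness up to \<open>H\<close> on finite sets.\<close>

lemma compat_locally_unique:
  assumes \<beta>: "inj_on \<beta> B" and \<theta>: "compat \<beta> w \<theta>" and "finite S"
  shows "\<exists>k. \<forall>w' \<theta>'. (\<forall>i\<in>S. \<forall>j<k. w' (i, j) = w (i, j)) \<longrightarrow> compat \<beta> w' \<theta>' \<longrightarrow>
    (\<exists>h\<in>H. \<forall>i\<in>S. \<theta>' i = h (\<theta> i))"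
proof -
  have inj: "inj_on \<theta> S" using \<theta> unfolding compat_def by (metis bij_is_inj inj_on_subset subset_UNIV)
  have "approx \<beta> w S \<theta>" using \<theta> \<open>finite S\<close> unfolding compat_def by blast
  then obtain k h where h: "h \<in> H" "\<And>i. i \<in> S \<Longrightarrow> map_option h (row_label \<beta> w k i) = Some (\<theta> i)"
    unfolding approx_def by metis
  have sep_k: "sep (row_label \<beta> w k) S" by (rule sep_if_inj[OF inj h(2)])
  have "\<exists>h\<in>H. \<forall>i\<in>S. \<theta>' i = h (\<theta> i)"
    if w': "\<forall>i\<in>S. \<forall>j<k. w' (i, j) = w (i, j)" and \<theta>': "compat \<beta> w' \<theta>'" for w' \<theta>'
  proof -
    have eq: "row_label \<beta> w' k i = row_label \<beta> w k i" if "i \<in> S" for i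
      using w' that label_cong[of k "\<lambda>j. w' (i, j)" "\<lambda>j. w (i, j)" d e] by (simp add: lab_def)
    then have "sep (row_label \<beta> w' k) S"
      using sep_k unfolding sep_def by (metis (no_types, lifting) inj_on_cong)
    moreover have "approx \<beta> w' S \<theta>'" "inj_on \<theta>' S"
      using \<theta>' \<open>finite S\<close> unfolding compat_def by (blast, metis bij_is_inj inj_on_subset subset_UNIV)
    ultimately obtain h' where h': "h' \<in> H"
      "\<And>i. i \<in> S \<Longrightarrow> map_option h' (row_label \<beta> w' k i) = Some (\<theta>' i)"
      using approx_at[OF \<beta>] by metis
    have "\<theta>' i = (h' \<circ> inv h) (\<theta> i)" if i: "i \<in> S" for i
    proof -
      obtain y where "row_label \<beta> w k i = Some y" using h(2)[OF i] by auto
      then have "h y = \<theta> i" "h' y = \<theta>' i" using h(2)[OF i] h'(2)[OF i] eq[OF i] by simp_all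
      moreover have "inv h (h y) = y" using bij_in[OF h(1)] by (simp add: bij_def)
      ultimately show ?thesis by (metis comp_apply)
    qed
    then show ?thesis using comp_in[OF h'(1) inv_in[OF h(1)]] by blast
  qed
  then show ?thesis by blast
qed

text \<open>Permuting the rows and the placement by \<open>g\<close> moves every label along with
  its position, at every stage. This is the source of the symmetry of the laws below.\<close>

lemma compat_permute:
  assumes \<beta>: "inj_on \<beta> B" and \<theta>: "compat \<beta> w \<theta>" and g: "bij g" and \<beta>': "\<And>b. b \<in> B \<Longrightarrow> \<beta>' b = g (\<beta> b)"
  shows "compat \<beta>' (\<lambda>(i, k). w (inv g i, k)) (\<theta> \<circ> inv g)"
proof -
  have "inj_on \<beta>' B" using \<beta> \<beta>' g by (auto simp: inj_on_def bij_def)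
  have inv_g: "inv g (g i) = i" "g (inv g i) = i" for i using g by (simp_all add: bij_def surj_f_inv_f)
  have im: "\<beta>' ` B = g ` \<beta> ` B" using \<beta>' by (auto simp: image_iff)
  have lab: "row_label \<beta>' (\<lambda>(i, k). w (inv g i, k)) k i = row_label \<beta> w k (inv g i)" for k i
  proof (cases "inv g i \<in> \<beta> ` B")
    case True
    then obtain b where b: "b \<in> B" "inv g i = \<beta> b" by blast
    then have "i = \<beta>' b" using \<beta>' inv_g by metis
    then show ?thesis using b row_label_in_B[OF \<beta>] row_label_in_B[OF \<open>inj_on \<beta>' B\<close>] by simp
  next
    case False
    then have "i \<notin> \<beta>' ` B" using inv_g(1) unfolding im by auto
    then show ?thesis using False by (simp add: lab_def)
  qed
  have "approx \<beta>' (\<lambda>(i, k). w (inv g i, k)) S (\<theta> \<circ> inv g)" if "finite S" for S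
  proof -
    have "approx \<beta> w (inv g ` S) \<theta>" using \<theta> that unfolding compat_def by blast
    then show ?thesis unfolding approx_def lab by simp
  qed
  moreover have "bij (\<theta> \<circ> inv g)"
    using \<theta> g unfolding compat_def by (blast intro: bij_comp bij_imp_bij_inv)
  ultimately show ?thesis unfolding compat_def by blast
qed

end

section \<open>Random rows\<close>

text \<open>A Borel-Cantelli argument: patterns on disjoint blocks are independent, so failure on
  \<open>Suc m\<close> consecutive blocks has probability at most \<open>(1 - q) ^ Suc m\<close>,
  which tends to \<open>0\<close>.\<close>

lemma AE_infinitely_often_pattern:
  fixes p :: "nat pmf" and K :: "nat \<Rightarrow> 'i set" and u :: "'i \<Rightarrow> nat"
  assumes finite_K: "\<And>k. finite (K k)" and disj: "disjoint_family K"
    and q: "q > 0" "\<And>k. q \<le> (\<Prod>i\<in>K k. pmf p (u i))"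
  shows "AE w in PiM UNIV (\<lambda>_. measure_pmf p). \<exists>\<^sub>\<infinity>k. \<forall>i\<in>K k. w i = u i"
proof -
  let ?M = "\<lambda>_ :: 'i. measure_pmf p"
  interpret product_prob_space ?M UNIV by unfold_locales
  define N where "N = PiM UNIV ?M"
  have space_N: "space N = UNIV" by (simp add: N_def space_PiM)
  interpret N: prob_space N unfolding N_def by (rule prob_space_PiM) unfold_locales
  have "N.indep_vars ?M (\<lambda>i w. w i) UNIV"
  proof (subst N.indep_vars_iff_distr_eq_PiM)
    show "distr N (PiM UNIV ?M) (\<lambda>w. \<lambda>i\<in>UNIV. w i) = (\<Pi>\<^sub>M i\<in>UNIV. distr N (measure_pmf p) (\<lambda>w. w i))"
      unfolding N_def by (simp add: PiM_component restrict_UNIV distr_id)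
  qed (simp_all add: N_def)
  then have ind: "N.indep_vars (\<lambda>k. PiM (K k) ?M) (\<lambda>k w. restrict w (K k)) UNIV"
    by (rule N.indep_vars_restrict[where K = K]) (use disj in auto)
  define A where "A k = space (PiM (K k) ?M) - (\<Pi>\<^sub>E i\<in>K k. {u i})" for k
  have A: "A k \<in> sets (PiM (K k) ?M)" for k
    unfolding A_def by (intro sets.compl_sets sets_PiM_I_finite finite_K) simp
  have vimage: "(\<lambda>w. restrict w (K k)) -` A k \<inter> space N = {w. \<not> (\<forall>i\<in>K k. w i = u i)}" for k
    by (auto simp: A_def space_N space_PiM PiE_iff)
  have pattern: "Measurable.pred N (\<lambda>w. \<forall>i\<in>K k. w i = u i)" for k
    unfolding N_def by (intro pred_intros_finite finite_K) measurable
  have not_pattern: "{w. \<not> (\<forall>i\<in>K k. w i = u i)} \<in> sets N" for k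
    unfolding vimage[symmetric] by (rule measurable_sets[OF _ A]) (simp add: N_def)
  have Collect: "N.prob {w. \<not> (\<forall>i\<in>K k. w i = u i)} \<le> 1 - q" for k
  proof -
    have *: "{w. \<forall>i\<in>K k. w i = u i} \<in> sets N"
      using pattern[of k] by (simp add: pred_def space_N)
    have "emeasure N {w \<in> space N. \<forall>i\<in>K k. w i \<in> {u i}} = (\<Prod>i\<in>K k. emeasure (measure_pmf p) {u i})"
      unfolding N_def by (rule emeasure_PiM_Collect) (auto simp: finite_K)
    then have "N.prob {w. \<forall>i\<in>K k. w i = u i} = (\<Prod>i\<in>K k. pmf p (u i))"
      by (simp add: space_N N.emeasure_eq_measure emeasure_pmf_single prod_ennreal prod_nonneg)
    moreover have "{w. \<not> (\<forall>i\<in>K k. w i = u i)} = space N - {w. \<forall>i\<in>K k. w i = u i}"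
      by (auto simp: space_N)
    ultimately show ?thesis using N.prob_compl[OF *] q(2)[of k] by simp
  qed
  have tail: "AE w in N. \<exists>k>n. \<forall>i\<in>K k. w i = u i" for n
  proof -
    define E where "E = {w. \<forall>k>n. \<not> (\<forall>i\<in>K k. w i = u i)}"
    have "Measurable.pred N (\<lambda>w. \<forall>k>n. \<not> (\<forall>i\<in>K k. w i = u i))"
      using pattern by measurable
    then have E_in: "E \<in> sets N" by (simp add: pred_def space_N E_def)
    have "N.prob E \<le> (1 - q) ^ Suc m" for m
    proof -
      have "N.prob E \<le> N.prob (\<Inter>k\<in>{Suc n..Suc n + m}. (\<lambda>w. restrict w (K k)) -` A k \<inter> space N)"
        unfolding vimage
      proof (rule N.finite_measure_mono)
        show "(\<Inter>k\<in>{Suc n..Suc n + m}. {w. \<not> (\<forall>i\<in>K k. w i = u i)}) \<in> N.events"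
          by (intro sets.finite_INT not_pattern) auto
      qed (auto simp: E_def)
      also have "\<dots> = (\<Prod>k\<in>{Suc n..Suc n + m}. N.prob ((\<lambda>w. restrict w (K k)) -` A k \<inter> space N))"
        by (rule N.indep_varsD[OF ind]) (auto simp: A)
      also have "\<dots> \<le> (\<Prod>k\<in>{Suc n..Suc n + m}. 1 - q)"
        unfolding vimage by (intro prod_mono conjI measure_nonneg Collect)
      finally show ?thesis by simp
    qed
    moreover have "0 \<le> 1 - q" using Collect[of 0] order_trans[OF measure_nonneg] by blast
    then have "(\<lambda>m. (1 - q) ^ Suc m) \<longlonglongrightarrow> 0"
      using q(1) by (intro LIMSEQ_Suc LIMSEQ_realpow_zero) auto
    ultimately have "N.prob E \<le> 0" by (intro LIMSEQ_le_const) auto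
    then have "E \<in> null_sets N" 
      using E_in by (simp add: N.emeasure_eq_measure null_sets_def measure_le_0_iff)
    then show ?thesis by (rule AE_I') (auto simp: E_def)
  qed
  then have "AE w in N. \<forall>n. \<exists>k>n. \<forall>i\<in>K k. w i = u i" by (simp add: AE_all_countable)
  then show ?thesis unfolding INFM_nat N_def[symmetric] .
qed

text \<open>The type \<^typ>\<open>nat\<close> is not an instance of \<^class>\<open>polish_space\<close>, so inner regularity is
  transferred from sequences over its discrete copy.\<close>

lemma compact_exhaustion:
  fixes P :: "('i::countable \<Rightarrow> nat) measure"
  assumes P: "sets P = sets borel" "finite_measure P" and G: "G \<in> sets borel"
  shows "\<exists>K :: nat \<Rightarrow> _. (\<forall>n. compact (K n) \<and> K n \<subseteq> G) \<and> emeasure P (\<Union>n. K n) = emeasure P G"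
proof -
  interpret finite_measure P by fact
  define enc where "enc w = (\<lambda>i. discrete (w i))" for w :: "'i \<Rightarrow> nat"
  define dec where "dec w = (\<lambda>i. of_discrete (w i))" for w :: "'i \<Rightarrow> nat discrete"
  have cont_enc: "continuous_on UNIV enc"
    unfolding enc_def
    by (intro continuous_on_coordinatewise_then_product continuous_on_compose2[OF _ continuous_on_product_coordinates])
      auto
  have cont_dec: "continuous_on UNIV dec"
    unfolding dec_def
  proof (intro continuous_on_coordinatewise_then_product continuous_on_compose2[OF _ continuous_on_product_coordinates])
    show "continuous_on UNIV (of_discrete :: nat discrete \<Rightarrow> nat)"
      by (simp add: continuous_on_open_vimage open_discrete)
  qed auto
  have inv: "dec (enc w) = w" "enc (dec v) = v" for w v
    by (simp_all add: dec_def enc_def discrete_inverse of_discrete_inverse)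
  have [measurable]: "enc \<in> P \<rightarrow>\<^sub>M borel"
    using borel_measurable_continuous_onI[OF cont_enc] P(1) by (simp cong: measurable_cong_sets)
  have [measurable]: "dec \<in> borel \<rightarrow>\<^sub>M borel"
    by (rule borel_measurable_continuous_onI[OF cont_dec])
  define Q where "Q = distr P borel enc"
  have space_P: "space P = UNIV" using sets_eq_imp_space_eq[OF P(1)] by simp
  have emeasure_Q: "emeasure Q X = emeasure P (dec ` X)" if "X \<in> sets borel" for X
  proof -
    have "enc -` X = dec ` X" using inv by (auto simp: image_iff) metis
    then show ?thesis using that by (simp add: Q_def emeasure_distr space_P)
  qed
  have encG: "enc ` G \<in> sets borel"
  proof -
    have "dec -` G \<inter> space borel \<in> sets borel" using G by measurable
    moreover have "dec -` G = enc ` G" using inv by (auto simp: image_iff) metis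
    ultimately show ?thesis by simp
  qed
  have regular: "emeasure Q (enc ` G) = (SUP C \<in> {C. C \<subseteq> enc ` G \<and> compact C}. emeasure Q C)"
  proof (rule inner_regular)
    show "emeasure Q (space Q) \<noteq> \<infinity>" by (simp add: Q_def emeasure_distr)
  qed (simp_all add: Q_def encG[unfolded Q_def])
  have "{} \<in> {C. C \<subseteq> enc ` G \<and> compact C}" by simp
  then have "{C. C \<subseteq> enc ` G \<and> compact C} \<noteq> {}" by blast
  \<comment> \<open>A sequence of compact sets approaches the supremum; the union of their copies
    contains each of them and so has the full measure of \<open>G\<close>.\<close>
  from ennreal_SUP_countable_SUP[OF this, of "emeasure Q"]
  obtain f :: "nat \<Rightarrow> ennreal" where
    f: "range f \<subseteq> emeasure Q ` {C. C \<subseteq> enc ` G \<and> compact C}"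
      "(SUP C \<in> {C. C \<subseteq> enc ` G \<and> compact C}. emeasure Q C) = (SUP n. f n)"
    by blast
  have "\<forall>n. \<exists>C. C \<subseteq> enc ` G \<and> compact C \<and> f n = emeasure Q C" using f(1) by blast
  then obtain C where C: "\<And>n. C n \<subseteq> enc ` G" "\<And>n. compact (C n)" "\<And>n. f n = emeasure Q (C n)"
    by metis
  define K where "K n = dec ` C n" for n
  have K: "compact (K n)" "K n \<subseteq> G" for n
    using C(1)[of n] C(2)[of n] continuous_on_subset[OF cont_dec] inv
    by (auto simp: K_def intro!: compact_continuous_image)
  have f_K: "f n = emeasure P (K n)" for n
    unfolding C(3) K_def by (intro emeasure_Q borel_compact C(2))
  have "dec ` enc ` G = G" by (simp add: image_image inv)
  then have "emeasure P G = (SUP n. emeasure P (K n))"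
    using regular f(2) emeasure_Q[OF encG] by (simp add: f_K)
  moreover have K_in: "K n \<in> sets P" for n
  proof -
    have "enc -` C n \<inter> space P \<in> sets P" using borel_compact[OF C(2)] by measurable
    moreover have "enc -` C n = K n" unfolding K_def using inv by (auto simp: image_iff) metis
    ultimately show ?thesis by (simp add: space_P)
  qed
  then have "(SUP n. emeasure P (K n)) \<le> emeasure P (\<Union>n. K n)"
    by (intro SUP_least emeasure_mono) auto
  moreover have "emeasure P (\<Union>n. K n) \<le> emeasure P G"
    by (rule emeasure_mono) (use K G P in auto)
  ultimately show ?thesis using K by (intro exI[of _ K]) (auto intro: antisym)
qed

section \<open>The space of structures\<close>

lemma map_in_tuples [simp]: "map f a \<in> tuples n \<longleftrightarrow> a \<in> tuples n"
  by (simp add: tuples_def)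

lemma logic_action_in_Str: "logic_action L g N \<in> Str L"
  by (simp add: logic_action_def Str_def)

lemma logic_action_rel:
  "R \<in> rels L \<Longrightarrow> a \<in> tuples (rel_arity L R) \<Longrightarrow>
    fst (logic_action L g N) R a = fst N R (map (inv g) a)"
  by (simp add: logic_action_def)

lemma logic_action_fun:
  "f \<in> funs L \<Longrightarrow> a \<in> tuples (fun_arity L f) \<Longrightarrow>
    snd (logic_action L g N) f a = g (snd N f (map (inv g) a))"
  by (simp add: logic_action_def)

lemma Str_eqI:
  assumes "M \<in> Str L" "N \<in> Str L"
    and "\<And>R a. R \<in> rels L \<Longrightarrow> a \<in> tuples (rel_arity L R) \<Longrightarrow> fst M R a = fst N R a"
    and "\<And>f a. f \<in> funs L \<Longrightarrow> a \<in> tuples (fun_arity L f) \<Longrightarrow> snd M f a = snd N f a"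
  shows "M = N"
proof (rule prod_eqI)
  show "fst M = fst N"
  proof (rule PiE_ext)
    show "fst M R = fst N R" if "R \<in> rels L" for R
      by (rule PiE_ext[of _ "tuples (rel_arity L R)" "\<lambda>_. UNIV"])
        (use assms that in \<open>auto simp: Str_def PiE_iff\<close>)
  qed (use assms in \<open>auto simp: Str_def\<close>)
  show "snd M = snd N"
  proof (rule PiE_ext)
    show "snd M f = snd N f" if "f \<in> funs L" for f
      by (rule PiE_ext[of _ "tuples (fun_arity L f)" "\<lambda>_. UNIV"])
        (use assms that in \<open>auto simp: Str_def PiE_iff\<close>)
  qed (use assms in \<open>auto simp: Str_def\<close>)
qed

lemma logic_action_comp:
  assumes "bij g" "bij h"
  shows "logic_action L g (logic_action L h N) = logic_action L (g \<circ> h) N"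
proof -
  have "map (inv h) (map (inv g) a) = map (inv (g \<circ> h)) a" for a
    using assms by (simp add: o_inv_distrib)
  then show ?thesis
    by (intro Str_eqI[where L = L] logic_action_in_Str) (simp_all only: logic_action_rel logic_action_fun map_in_tuples comp_apply)
qed

lemma logic_action_id: "N \<in> Str L \<Longrightarrow> logic_action L id N = N"
  by (rule Str_eqI[OF logic_action_in_Str]) (simp_all add: logic_action_rel logic_action_fun)

lemma logic_action_inv:
  assumes "bij g" "N \<in> Str L"
  shows "logic_action L (inv g) (logic_action L g N) = N"
    and "logic_action L g (logic_action L (inv g) N) = N"
proof -
  have "inv g \<circ> g = id" "g \<circ> inv g = id"
    using assms(1) by (simp_all add: bij_def surj_iff)
  then show "logic_action L (inv g) (logic_action L g N) = N"
    and "logic_action L g (logic_action L (inv g) N) = N"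
    using assms by (simp_all add: logic_action_comp bij_imp_bij_inv logic_action_id)
qed

lemma isomorphism_logic_action: "bij g \<Longrightarrow> isomorphism L g M (logic_action L g M)"
  by (simp add: isomorphism_def logic_action_rel logic_action_fun bij_def)

lemma continuous_map_into_discreteI:
  fixes f :: "'a \<Rightarrow> 'b"
  assumes "\<And>x. x \<in> topspace X \<Longrightarrow> \<exists>U. openin X U \<and> x \<in> U \<and> (\<forall>y\<in>U. f y = f x)"
  shows "continuous_map X (discrete_topology UNIV) f"
  unfolding continuous_map_def
proof (intro conjI allI impI)
  fix V :: "'b set"
  show "openin X {x \<in> topspace X. f x \<in> V}"
  proof (subst openin_subopen, intro ballI)
    fix x assume x: "x \<in> {x \<in> topspace X. f x \<in> V}"
    then obtain U where U: "openin X U" "x \<in> U" "\<forall>y\<in>U. f y = f x" using assms by blast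
    have "y \<in> topspace X \<and> f y \<in> V" if "y \<in> U" for y
      using U(3) x that openin_subset[OF U(1)] by auto
    then show "\<exists>T. openin X T \<and> x \<in> T \<and> T \<subseteq> {x \<in> topspace X. f x \<in> V}"
      using U by blast
  qed
qed simp

lemma continuous_map_StrI:
  assumes "\<And>x. x \<in> topspace X \<Longrightarrow> \<Phi> x \<in> Str L"
    and "\<And>R a. R \<in> rels L \<Longrightarrow> a \<in> tuples (rel_arity L R) \<Longrightarrow>
      continuous_map X (discrete_topology UNIV) (\<lambda>x. fst (\<Phi> x) R a)"
    and "\<And>f a. f \<in> funs L \<Longrightarrow> a \<in> tuples (fun_arity L f) \<Longrightarrow>
      continuous_map X (discrete_topology UNIV) (\<lambda>x. snd (\<Phi> x) f a)"
  shows "continuous_map X (Str_topology L) \<Phi>"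
proof -
  have "fst (\<Phi> x) \<in> (\<Pi>\<^sub>E R\<in>rels L. tuples (rel_arity L R) \<rightarrow>\<^sub>E UNIV)"
    "snd (\<Phi> x) \<in> (\<Pi>\<^sub>E f\<in>funs L. tuples (fun_arity L f) \<rightarrow>\<^sub>E UNIV)" if "x \<in> topspace X" for x
    using assms(1)[OF that] by (auto simp: Str_def mem_Times_iff)
  then show ?thesis
    unfolding Str_topology_def continuous_map_pairwise continuous_map_componentwise
    using assms(2,3) by (simp add: PiE_iff image_subset_iff)
qed

lemma continuous_map_rel:
  assumes "R \<in> rels L" "a \<in> tuples (rel_arity L R)"
  shows "continuous_map (Str_topology L) (discrete_topology UNIV) (\<lambda>N. fst N R a)"
  using continuous_map_id[of "Str_topology L"] assms
  unfolding Str_topology_def continuous_map_pairwise continuous_map_componentwise by auto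

lemma continuous_map_fun:
  assumes "f \<in> funs L" "a \<in> tuples (fun_arity L f)"
  shows "continuous_map (Str_topology L) (discrete_topology UNIV) (\<lambda>N. snd N f a)"
  using continuous_map_id[of "Str_topology L"] assms
  unfolding Str_topology_def continuous_map_pairwise continuous_map_componentwise by auto

lemma continuous_map_logic_action:
  "continuous_map (Str_topology L) (Str_topology L) (logic_action L g)"
proof (rule continuous_map_StrI)
  fix R a assume "R \<in> rels L" "a \<in> tuples (rel_arity L R)"
  then show "continuous_map (Str_topology L) (discrete_topology UNIV) (\<lambda>N. fst (logic_action L g N) R a)"
    by (simp add: logic_action_rel continuous_map_rel)
next
  fix f a assume f: "f \<in> funs L" "a \<in> tuples (fun_arity L f)"
  have "continuous_map (Str_topology L) (discrete_topology UNIV) (g \<circ> (\<lambda>N. snd N f (map (inv g) a)))"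
    by (rule continuous_map_compose[OF continuous_map_fun]) (use f in auto)
  then show "continuous_map (Str_topology L) (discrete_topology UNIV) (\<lambda>N. snd (logic_action L g N) f a)"
    using f by (simp add: logic_action_fun comp_def)
qed (rule logic_action_in_Str)

text \<open>Compact sets of structures are thereby closed, hence Borel; this is applied to images of
  compact sets of rows.\<close>

lemma Hausdorff_Str_topology: "Hausdorff_space (Str_topology L)"
  by (simp add: Str_topology_def Hausdorff_space_prod_topology Hausdorff_space_product_topology)

lemma space_borel_Str: "space (borel_Str L) = Str L"
  and sets_borel_Str: "sets (borel_Str L) = sigma_sets (Str L) {U. openin (Str_topology L) U}"
proof -
  have "{U. openin (Str_topology L) U} \<subseteq> Pow (Str L)"
    using openin_subset by fastforce
  then show "space (borel_Str L) = Str L"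
    and "sets (borel_Str L) = sigma_sets (Str L) {U. openin (Str_topology L) U}"
    by (simp_all add: borel_Str_def)
qed

lemma openin_in_borel_Str: "openin (Str_topology L) U \<Longrightarrow> U \<in> sets (borel_Str L)"
  by (auto simp: sets_borel_Str)

lemma closedin_in_borel_Str: "closedin (Str_topology L) C \<Longrightarrow> C \<in> sets (borel_Str L)"
  using sets.compl_sets[OF openin_in_borel_Str, of L "Str L - C"]
  by (simp add: closedin_def space_borel_Str double_diff)

lemma measurable_borel_StrI:
  assumes "\<Phi> \<in> space M \<rightarrow> Str L"
    and "\<And>U. openin (Str_topology L) U \<Longrightarrow> \<Phi> -` U \<inter> space M \<in> sets M"
  shows "\<Phi> \<in> M \<rightarrow>\<^sub>M borel_Str L"
  unfolding borel_Str_def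
proof (rule measurable_measure_of)
  show "{U. openin (Str_topology L) U} \<subseteq> Pow (Str L)" using openin_subset by fastforce
qed (use assms in auto)

lemma measurable_logic_action: "logic_action L g \<in> borel_Str L \<rightarrow>\<^sub>M borel_Str L"
proof (rule measurable_borel_StrI)
  fix U assume "openin (Str_topology L) U"
  then have "openin (Str_topology L) {N \<in> topspace (Str_topology L). logic_action L g N \<in> U}"
    by (rule openin_continuous_map_preimage[OF continuous_map_logic_action])
  moreover have "{N \<in> topspace (Str_topology L). logic_action L g N \<in> U} = logic_action L g -` U \<inter> space (borel_Str L)"
    by (auto simp: space_borel_Str)
  ultimately show "logic_action L g -` U \<inter> space (borel_Str L) \<in> sets (borel_Str L)"
    using openin_in_borel_Str by metis
qed (simp add: logic_action_in_Str)

section \<open>Automorphisms and algebraic closure\<close>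

lemma Aut_bij: "h \<in> Aut L M \<Longrightarrow> bij h"
  by (simp add: Aut_def isomorphism_def)

lemma Aut_rel:
  "h \<in> Aut L M \<Longrightarrow> R \<in> rels L \<Longrightarrow> a \<in> tuples (rel_arity L R) \<Longrightarrow> fst M R (map h a) = fst M R a"
  unfolding Aut_def isomorphism_def by fastforce

lemma Aut_fun:
  "h \<in> Aut L M \<Longrightarrow> f \<in> funs L \<Longrightarrow> a \<in> tuples (fun_arity L f) \<Longrightarrow> snd M f (map h a) = h (snd M f a)"
  unfolding Aut_def isomorphism_def by fastforce

lemma id_in_Aut: "id \<in> Aut L M"
  by (simp add: Aut_def isomorphism_def)

lemma comp_in_Aut:
  assumes "g \<in> Aut L M" "h \<in> Aut L M"
  shows "g \<circ> h \<in> Aut L M"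
proof -
  have "fst M R a = fst M R (map (g \<circ> h) a)" if "R \<in> rels L" "a \<in> tuples (rel_arity L R)" for R a
    using Aut_rel[OF assms(1) that(1), of "map h a"] Aut_rel[OF assms(2) that] that(2) by simp
  moreover have "(g \<circ> h) (snd M f a) = snd M f (map (g \<circ> h) a)"
    if "f \<in> funs L" "a \<in> tuples (fun_arity L f)" for f a
    using Aut_fun[OF assms(1) that(1), of "map h a"] Aut_fun[OF assms(2) that] that(2) by simp
  ultimately show ?thesis
    using assms[THEN Aut_bij] unfolding Aut_def isomorphism_def by (blast intro: bij_comp)
qed

lemma inv_in_Aut:
  assumes h: "h \<in> Aut L M"
  shows "inv h \<in> Aut L M"
proof -
  have "bij h" by (rule Aut_bij[OF h])
  then have inv: "inv h (h x) = x" "map h (map (inv h) a) = a" for x a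
    by (simp_all add: bij_def surj_f_inv_f map_idI)
  have "fst M R a = fst M R (map (inv h) a)" if "R \<in> rels L" "a \<in> tuples (rel_arity L R)" for R a
    using Aut_rel[OF h that(1), of "map (inv h) a"] that by (simp only: inv map_in_tuples)
  moreover have "inv h (snd M f a) = snd M f (map (inv h) a)"
    if "f \<in> funs L" "a \<in> tuples (fun_arity L f)" for f a
    using Aut_fun[OF h that(1), of "map (inv h) a"] that by (simp only: inv map_in_tuples)
  ultimately show ?thesis
    using bij_imp_bij_inv[OF \<open>bij h\<close>] unfolding Aut_def isomorphism_def by blast
qed

text \<open>For the orbits: \<open>x\<close> is not algebraic over a list enumerating
  \<open>A \<union> B\<close>, and the stabilizer of that list is the stabilizer of \<open>A\<close>
  inside the stabilizer of \<open>B\<close>.\<close>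

lemma stabilizer_group_Aut:
  assumes B: "finite B" "\<And>a. acl L a M \<subseteq> set a \<union> B"
  shows "stabilizer_group (pointwise_stabilizer (Aut L M) B) B"
proof
  let ?H = "pointwise_stabilizer (Aut L M) B"
  show "inv h \<in> ?H" if "h \<in> ?H" for h
  proof -
    have "h \<in> Aut L M" "\<And>x. x \<in> B \<Longrightarrow> h x = x" using that by (auto simp: pointwise_stabilizer_def)
    moreover from this have "inv h x = x" if "x \<in> B" for x
      using that by (intro inv_f_eq bij_is_inj Aut_bij) auto
    ultimately show ?thesis using inv_in_Aut[of h L M] by (simp add: pointwise_stabilizer_def)
  qed
  show "bij h" if "h \<in> ?H" for h
    using that Aut_bij[of h L M] by (simp add: pointwise_stabilizer_def)
  show "g \<circ> h \<in> ?H" if "g \<in> ?H" "h \<in> ?H" for g h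
    using that comp_in_Aut[of g L M h] by (simp add: pointwise_stabilizer_def)
  fix A x assume A: "finite A" "x \<notin> A \<union> B"
  then have "finite (A \<union> B)" using B(1) by simp
  from finite_list[OF this] obtain a where a: "set a = A \<union> B" by blast
  have "x \<notin> acl L a M" using B(2)[of a] A(2) a by blast
  then have "infinite ((\<lambda>g. g x) ` pointwise_stabilizer (Aut L M) (A \<union> B))" by (simp add: acl_def a)
  moreover have "(\<lambda>g. g x) ` pointwise_stabilizer (Aut L M) (A \<union> B) = {h x |h. h \<in> ?H \<and> (\<forall>a\<in>A. h a = a)}"
    by (auto simp: pointwise_stabilizer_def)
  ultimately show "infinite {h x |h. h \<in> ?H \<and> (\<forall>a\<in>A. h a = a)}" by simp
qed (simp_all add: pointwise_stabilizer_def id_in_Aut B(1))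

text \<open>An automorphism fixing the arguments fixes the value, so the orbit is a
  singleton.\<close>

lemma fun_value_in_acl:
  assumes "f \<in> funs L" "a \<in> tuples (fun_arity L f)"
  shows "snd M f a \<in> acl L a M"
proof -
  have "g (snd M f a) = snd M f a" if "g \<in> pointwise_stabilizer (Aut L M) (set a)" for g
  proof -
    have "map g a = a" using that by (simp add: pointwise_stabilizer_def map_idI)
    then show ?thesis using Aut_fun[of g L M f a] that assms by (simp add: pointwise_stabilizer_def)
  qed
  then have "(\<lambda>g. g (snd M f a)) ` pointwise_stabilizer (Aut L M) (set a) \<subseteq> {snd M f a}" by blast
  then show ?thesis unfolding acl_def by (simp add: finite_subset)
qed

text \<open>Function values are algebraic over their arguments, so that the pull-back of \<open>M\<close> along \<open>\<theta>\<close>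
  at a tuple depends only on finitely many values of \<open>\<theta>\<close>, up to automorphisms of \<open>M\<close>.\<close>

lemma logic_action_fun_cong:
  assumes acl: "\<And>a. acl L a M \<subseteq> set a \<union> B"
    and bij: "bij \<theta>" "bij \<theta>'" and h: "h \<in> Aut L M"
    and S: "set a \<subseteq> S" "inv \<theta> ` B \<subseteq> S" "\<And>i. i \<in> S \<Longrightarrow> \<theta>' i = h (\<theta> i)"
    and f: "f \<in> funs L" "a \<in> tuples (fun_arity L f)"
  shows "snd (logic_action L (inv \<theta>') M) f a = snd (logic_action L (inv \<theta>) M) f a"
proof -
  define x where "x = snd M f (map \<theta> a)"
  have "x \<in> acl L (map \<theta> a) M" unfolding x_def by (rule fun_value_in_acl) (use f in simp_all)
  then have "x \<in> \<theta> ` set a \<union> B" using acl[of "map \<theta> a"] by auto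
  \<comment> \<open>The preimage of the value is an argument or the position of a point of
    \<open>B\<close>; both lie in \<open>S\<close>, where \<open>\<theta>'\<close> and
    \<open>h \<circ> \<theta>\<close> agree.\<close>
  then have "inv \<theta> x \<in> S" using S(1,2) bij(1) by (auto simp: bij_def)
  then have "\<theta>' (inv \<theta> x) = h x" using S(3) bij(1) by (simp add: bij_def surj_f_inv_f)
  then have eq: "inv \<theta>' (h x) = inv \<theta> x" using bij(2) by (metis bij_inv_eq_iff)
  have map: "map \<theta>' a = map h (map \<theta> a)" using S(1,3) by (simp add: subset_iff)
  have "snd M f (map \<theta>' a) = h x"
    unfolding map x_def by (rule Aut_fun[OF h f(1)]) (use f(2) in simp)
  then show ?thesis using eq f bij by (simp add: logic_action_fun inv_inv_eq x_def)
qed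

lemma logic_action_rel_cong:
  assumes bij: "bij \<theta>" "bij \<theta>'" and h: "h \<in> Aut L M"
    and a: "\<And>i. i \<in> set a \<Longrightarrow> \<theta>' i = h (\<theta> i)"
    and R: "R \<in> rels L" "a \<in> tuples (rel_arity L R)"
  shows "fst (logic_action L (inv \<theta>') M) R a = fst (logic_action L (inv \<theta>) M) R a"
proof -
  have map: "map \<theta>' a = map h (map \<theta> a)" using a by simp
  have "fst M R (map \<theta>' a) = fst M R (map \<theta> a)"
    unfolding map by (rule Aut_rel[OF h R(1)]) (use R(2) in simp)
  then show ?thesis using R bij by (simp add: logic_action_rel inv_inv_eq)
qed

section \<open>The quasi-invariant measure\<close>

text \<open>Identical distributions make the law invariant under permutations of the rows; the
  geometric law gives every number positive probability, on which \<open>AE_good\<close>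
  relies.\<close>

definition row_measure :: "(nat \<times> nat \<Rightarrow> nat) measure" where
  "row_measure = PiM UNIV (\<lambda>_. measure_pmf (geometric_pmf (1/2)))"

lemma prob_space_row_measure: "prob_space row_measure"
  unfolding row_measure_def by (rule prob_space_PiM) (rule prob_space_measure_pmf)

lemma sets_row_measure [measurable_cong]: "sets row_measure = sets borel"
proof -
  have "sets row_measure = sets (PiM UNIV (\<lambda>_. borel :: nat measure))"
    unfolding row_measure_def by (rule sets_PiM_cong) (simp_all add: sets_borel_eq_count_space)
  then show ?thesis by (simp add: sets_PiM_equal_borel)
qed

lemma space_row_measure [simp]: "space row_measure = UNIV"
  by (simp add: row_measure_def space_PiM)

lemma measurable_coordinate: "(\<lambda>w. w p) \<in> row_measure \<rightarrow>\<^sub>M count_space UNIV"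
  unfolding row_measure_def by measurable

definition permute_rows :: "(nat \<Rightarrow> nat) \<Rightarrow> (nat \<times> nat \<Rightarrow> nat) \<Rightarrow> nat \<times> nat \<Rightarrow> nat" where
  "permute_rows g w = (\<lambda>(i, k). w (inv g i, k))"

lemma distr_permute_rows:
  assumes g: "bij g"
  shows "permute_rows g \<in> row_measure \<rightarrow>\<^sub>M row_measure"
    and "distr row_measure row_measure (permute_rows g) = row_measure"
proof -
  let ?f = "\<lambda>(i, k). (inv g i, k)" and ?M = "\<lambda>_. measure_pmf (geometric_pmf (1/2))"
  have eq: "permute_rows g = (\<lambda>w. \<lambda>p\<in>UNIV. w (?f p))"
    by (auto simp: permute_rows_def fun_eq_iff)
  show "permute_rows g \<in> row_measure \<rightarrow>\<^sub>M row_measure"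
    unfolding eq row_measure_def by (rule measurable_restrict) simp
  have "inj ?f" using bij_imp_bij_inv[OF g] by (auto simp: inj_on_def bij_def)
  then show "distr row_measure row_measure (permute_rows g) = row_measure"
    using distr_PiM_reindex[of UNIV ?M ?f UNIV]
    unfolding eq row_measure_def by (simp add: prob_space_measure_pmf)
qed

text \<open>Membership in \<open>good\<close> amounts to countably many conditions, each asking for
  a pattern on infinitely many blocks of a disjoint sequence, with probabilities bounded away from
  zero.\<close>

lemma AE_good: "AE w in row_measure. w \<in> good"
proof -
  let ?p = "geometric_pmf (1/2)"
  have pos: "0 < pmf ?p n" for n
    using set_pmf_geometric[of "1/2"] by (simp add: pmf_positive_iff)
  have "AE w in row_measure. \<exists>\<^sub>\<infinity>k. w (i, k) = 1 \<and> w (j, k) = 0" if "i \<noteq> j" for i j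
  proof -
    have "AE w in row_measure. \<exists>\<^sub>\<infinity>k. \<forall>p\<in>{(i, k), (j, k)}. w p = (if fst p = i then 1 else 0)"
      unfolding row_measure_def
    proof (rule AE_infinitely_often_pattern)
      show "0 < pmf ?p 1 * pmf ?p 0" using pos by simp
    qed (use that in \<open>auto simp: disjoint_family_on_def\<close>)
    then show ?thesis using that by simp
  qed
  moreover have "AE w in row_measure. \<exists>\<^sub>\<infinity>i. \<forall>k<length v. w (i, k) = v ! k" for v
  proof -
    have "AE w in row_measure. \<exists>\<^sub>\<infinity>i. \<forall>p\<in>{i} \<times> {..<length v}. w p = v ! snd p"
      unfolding row_measure_def
    proof (rule AE_infinitely_often_pattern)
      show "0 < (\<Prod>k<length v. pmf ?p (v ! k))" using pos by (simp add: prod_pos)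
      have eq: "(\<Prod>q\<in>{i} \<times> {..<length v}. pmf ?p (v ! snd q)) = (\<Prod>k<length v. pmf ?p (v ! k))" for i
        by (rule prod.reindex_bij_witness[of _ "\<lambda>k. (i, k)" snd]) auto
      show "(\<Prod>k<length v. pmf ?p (v ! k)) \<le> (\<Prod>q\<in>{i} \<times> {..<length v}. pmf ?p (v ! snd q))" for i
        by (simp only: eq order_refl)
    qed (auto simp: disjoint_family_on_def)
    then show ?thesis by (simp add: Ball_def)
  qed
  ultimately show ?thesis
    unfolding good_def by (simp add: AE_all_countable AE_conj_iff)
qed

lemma good_borel: "good \<in> sets borel"
proof -
  note measurable_coordinate[measurable]
  have "Measurable.pred row_measure (\<lambda>w. (\<forall>i j. i \<noteq> j \<longrightarrow> (\<forall>m. \<exists>k>m. w (i, k) = 1 \<and> w (j, k) = 0)) \<and>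
      (\<forall>v. \<forall>m. \<exists>i>m. \<forall>k<length v. w (i, k) = v ! k))"
    by measurable
  then show ?thesis
    by (simp add: pred_def good_def INFM_nat sets_row_measure)
qed

lemma permute_rows_good:
  assumes "bij g" "w \<in> good"
  shows "permute_rows g w \<in> good"
proof -
  have inj: "inv g i \<noteq> inv g j" if "i \<noteq> j" for i j
    using that bij_imp_bij_inv[OF assms(1)] by (auto simp: bij_def inj_on_def)
  have "infinite {i. \<forall>k<length v. w (inv g i, k) = v ! k}" for v
  proof -
    have "bij_betw g {i. \<forall>k<length v. w (i, k) = v ! k} {i. \<forall>k<length v. w (inv g i, k) = v ! k}"
      using assms(1) by (intro bij_betw_byWitness[of _ "inv g"]) (auto simp: bij_def surj_f_inv_f)
    moreover have "infinite {i. \<forall>k<length v. w (i, k) = v ! k}"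
      using assms(2) by (simp add: good_def frequently_cofinite)
    ultimately show ?thesis using bij_betw_finite by blast
  qed
  then show ?thesis
    using assms(2) inj unfolding good_def permute_rows_def by (simp add: frequently_cofinite)
qed

lemma open_agree:
  fixes w :: "'i \<Rightarrow> nat"
  assumes "finite I"
  shows "open {w'. \<forall>p\<in>I. w' p = w p}"
proof -
  have "open ((\<lambda>w'. w' p) -` {w p})" for p
    by (rule open_vimage[OF discrete_topology_class.open_discrete]) (rule continuous_on_product_coordinates)
  then have "open (\<Inter>p\<in>I. (\<lambda>w'. w' p) -` {w p})" using assms by (intro open_INT) auto
  also have "(\<Inter>p\<in>I. (\<lambda>w'. w' p) -` {w p}) = {w'. \<forall>p\<in>I. w' p = w p}" by auto
  finally show ?thesis .
qed

section \<open>The random copy of the structure\<close>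

locale structure_tree = label_tree H B F d e for H B F d e +
  fixes L :: "('r, 'f) language" and M :: "('r, 'f) struct"
  assumes M: "M \<in> Str L"
    and acl: "acl L a M \<subseteq> set a \<union> B"
    and H: "H = pointwise_stabilizer (Aut L M) B"
begin

text \<open>Acting by \<open>inv \<theta>\<close> pulls \<open>M\<close> back along
  \<open>\<theta>\<close>. The choice of \<open>\<theta>\<close> is immaterial by
  \<open>\<Phi>_eq\<close>; the default \<open>M\<close> keeps the map inside \<open>Str L\<close>
  and constant off the Borel set \<open>good\<close>.\<close>

definition \<Phi> :: "(nat \<Rightarrow> nat) \<Rightarrow> (nat \<times> nat \<Rightarrow> nat) \<Rightarrow> ('r, 'f) struct" where
  "\<Phi> \<beta> w = (if w \<in> good then logic_action L (inv (SOME \<theta>. compat \<beta> w \<theta>)) M else M)"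

lemma \<Phi>_in_Str: "\<Phi> \<beta> w \<in> Str L"
  by (simp add: \<Phi>_def M logic_action_in_Str)

lemma H_Aut: "h \<in> H \<Longrightarrow> h \<in> Aut L M"
  by (simp add: H pointwise_stabilizer_def)

lemma inv_compat_B:
  assumes "inj_on \<beta> B" "compat \<beta> w \<theta>"
  shows "inv \<theta> ` B = \<beta> ` B"
proof -
  have "inj \<theta>" using assms(2) by (simp add: compat_def bij_def)
  then show ?thesis
    using compat_on_B[OF assms] by (intro image_cong[OF refl]) (simp add: inv_f_eq)
qed

text \<open>The positions of \<open>B\<close> join those of \<open>a\<close> because function values
  are algebraic over the arguments and may lie in \<open>B\<close>. Taking \<open>w' = w\<close>
  gives independence of the choice of \<open>\<theta>\<close>; varying \<open>w'\<close> gives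
  continuity.\<close>

lemma logic_action_compat_locally_constant:
  assumes \<beta>: "inj_on \<beta> B" and \<theta>: "compat \<beta> w \<theta>"
  shows "\<exists>k. \<forall>w' \<theta>'. (\<forall>i\<in>set a \<union> \<beta> ` B. \<forall>j<k. w' (i, j) = w (i, j)) \<longrightarrow> compat \<beta> w' \<theta>' \<longrightarrow>
    (\<forall>R\<in>rels L. a \<in> tuples (rel_arity L R) \<longrightarrow>
       fst (logic_action L (inv \<theta>') M) R a = fst (logic_action L (inv \<theta>) M) R a) \<and>
    (\<forall>f\<in>funs L. a \<in> tuples (fun_arity L f) \<longrightarrow>
       snd (logic_action L (inv \<theta>') M) f a = snd (logic_action L (inv \<theta>) M) f a)"
proof -
  let ?S = "set a \<union> \<beta> ` B"
  have "finite ?S" by (simp add: finite_B)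
  from compat_locally_unique[OF \<beta> \<theta> this] obtain k where
    k: "\<And>w' \<theta>'. \<forall>i\<in>?S. \<forall>j<k. w' (i, j) = w (i, j) \<Longrightarrow> compat \<beta> w' \<theta>' \<Longrightarrow>
      \<exists>h\<in>H. \<forall>i\<in>?S. \<theta>' i = h (\<theta> i)" by blast
  have "fst (logic_action L (inv \<theta>') M) R a = fst (logic_action L (inv \<theta>) M) R a"
    if w': "\<forall>i\<in>?S. \<forall>j<k. w' (i, j) = w (i, j)" "compat \<beta> w' \<theta>'"
      and R: "R \<in> rels L" "a \<in> tuples (rel_arity L R)" for w' \<theta>' R
  proof -
    obtain h where h: "h \<in> H" "\<forall>i\<in>?S. \<theta>' i = h (\<theta> i)" using k[OF w'] by blast
    show ?thesis
      by (rule logic_action_rel_cong[OF _ _ H_Aut[OF h(1)] _ R]) (use \<theta> w' h(2) in \<open>auto simp: compat_def\<close>)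
  qed
  moreover have "snd (logic_action L (inv \<theta>') M) f a = snd (logic_action L (inv \<theta>) M) f a"
    if w': "\<forall>i\<in>?S. \<forall>j<k. w' (i, j) = w (i, j)" "compat \<beta> w' \<theta>'"
      and f: "f \<in> funs L" "a \<in> tuples (fun_arity L f)" for w' \<theta>' f
  proof -
    obtain h where h: "h \<in> H" "\<forall>i\<in>?S. \<theta>' i = h (\<theta> i)" using k[OF w'] by blast
    show ?thesis
      by (rule logic_action_fun_cong[OF acl _ _ H_Aut[OF h(1)] _ _ _ f, where S = ?S])
        (use \<theta> w' h(2) inv_compat_B[OF \<beta> \<theta>] in \<open>auto simp: compat_def\<close>)
  qed
  ultimately show ?thesis by (intro exI[of _ k]) blast
qed

lemma \<Phi>_eq:
  assumes \<beta>: "inj_on \<beta> B" and w: "w \<in> good" and \<theta>: "compat \<beta> w \<theta>"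
  shows "\<Phi> \<beta> w = logic_action L (inv \<theta>) M"
proof -
  define \<theta>' where "\<theta>' = (SOME \<theta>. compat \<beta> w \<theta>)"
  have \<theta>': "compat \<beta> w \<theta>'" unfolding \<theta>'_def by (rule someI[of "compat \<beta> w", OF \<theta>])
  have "logic_action L (inv \<theta>') M = logic_action L (inv \<theta>) M"
  proof (rule Str_eqI[OF logic_action_in_Str logic_action_in_Str])
    fix R a assume "R \<in> rels L" "a \<in> tuples (rel_arity L R)"
    then show "fst (logic_action L (inv \<theta>') M) R a = fst (logic_action L (inv \<theta>) M) R a"
      using logic_action_compat_locally_constant[OF \<beta> \<theta>, of a] \<theta>' by blast
  next
    fix f a assume "f \<in> funs L" "a \<in> tuples (fun_arity L f)"
    then show "snd (logic_action L (inv \<theta>') M) f a = snd (logic_action L (inv \<theta>) M) f a"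
      using logic_action_compat_locally_constant[OF \<beta> \<theta>, of a] \<theta>' by blast
  qed
  then show ?thesis using w by (simp add: \<Phi>_def \<theta>'_def)
qed

lemma continuous_map_\<Phi>:
  assumes \<beta>: "inj_on \<beta> B"
  shows "continuous_map (top_of_set good) (Str_topology L) (\<Phi> \<beta>)"
proof -
  have ex: "\<exists>U. openin (top_of_set good) U \<and> w \<in> U \<and>
    (\<forall>w'\<in>U. (\<forall>R\<in>rels L. a \<in> tuples (rel_arity L R) \<longrightarrow> fst (\<Phi> \<beta> w') R a = fst (\<Phi> \<beta> w) R a) \<and>
      (\<forall>f\<in>funs L. a \<in> tuples (fun_arity L f) \<longrightarrow> snd (\<Phi> \<beta> w') f a = snd (\<Phi> \<beta> w) f a))"
    if w: "w \<in> good" for w a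
  proof -
    obtain \<theta> where \<theta>: "compat \<beta> w \<theta>" using ex_compat[OF \<beta> w] by blast
    obtain k where k: "\<And>w' \<theta>'. \<forall>i\<in>set a \<union> \<beta> ` B. \<forall>j<k. w' (i, j) = w (i, j) \<Longrightarrow> compat \<beta> w' \<theta>' \<Longrightarrow>
      (\<forall>R\<in>rels L. a \<in> tuples (rel_arity L R) \<longrightarrow>
         fst (logic_action L (inv \<theta>') M) R a = fst (logic_action L (inv \<theta>) M) R a) \<and>
      (\<forall>f\<in>funs L. a \<in> tuples (fun_arity L f) \<longrightarrow>
         snd (logic_action L (inv \<theta>') M) f a = snd (logic_action L (inv \<theta>) M) f a)"
      using logic_action_compat_locally_constant[OF \<beta> \<theta>, of a] by blast
    let ?I = "(set a \<union> \<beta> ` B) \<times> {..<k}"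
    let ?U = "good \<inter> {w'. \<forall>p\<in>?I. w' p = w p}"
    have "openin (top_of_set good) ?U"
      by (intro openin_open_Int open_agree) (simp add: finite_B)
    moreover have "(\<forall>R\<in>rels L. a \<in> tuples (rel_arity L R) \<longrightarrow> fst (\<Phi> \<beta> w') R a = fst (\<Phi> \<beta> w) R a) \<and>
      (\<forall>f\<in>funs L. a \<in> tuples (fun_arity L f) \<longrightarrow> snd (\<Phi> \<beta> w') f a = snd (\<Phi> \<beta> w) f a)"
      if w': "w' \<in> ?U" for w'
    proof -
      have "w' \<in> good" using w' by blast
      then obtain \<theta>' where \<theta>': "compat \<beta> w' \<theta>'" using ex_compat[OF \<beta>] by blast
      have "\<forall>i\<in>set a \<union> \<beta> ` B. \<forall>j<k. w' (i, j) = w (i, j)" using w' by auto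
      from k[OF this \<theta>'] show ?thesis
        unfolding \<Phi>_eq[OF \<beta> w \<theta>] \<Phi>_eq[OF \<beta> \<open>w' \<in> good\<close> \<theta>'] .
    qed
    ultimately show ?thesis using w by (intro exI[of _ ?U]) blast
  qed
  show ?thesis
  proof (rule continuous_map_StrI[OF \<Phi>_in_Str]; rule continuous_map_into_discreteI)
    fix R a w assume "R \<in> rels L" "a \<in> tuples (rel_arity L R)" "w \<in> topspace (top_of_set good)"
    then show "\<exists>U. openin (top_of_set good) U \<and> w \<in> U \<and> (\<forall>w'\<in>U. fst (\<Phi> \<beta> w') R a = fst (\<Phi> \<beta> w) R a)"
      using ex[of w a] by (metis topspace_euclidean_subtopology)
  next
    fix f a w assume "f \<in> funs L" "a \<in> tuples (fun_arity L f)" "w \<in> topspace (top_of_set good)"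
    then show "\<exists>U. openin (top_of_set good) U \<and> w \<in> U \<and> (\<forall>w'\<in>U. snd (\<Phi> \<beta> w') f a = snd (\<Phi> \<beta> w) f a)"
      using ex[of w a] by (metis topspace_euclidean_subtopology)
  qed
qed

lemma measurable_\<Phi>:
  assumes \<beta>: "inj_on \<beta> B"
  shows "\<Phi> \<beta> \<in> row_measure \<rightarrow>\<^sub>M borel_Str L"
proof (rule measurable_borel_StrI)
  fix U assume "openin (Str_topology L) U"
  then have "openin (top_of_set good) {w \<in> topspace (top_of_set good). \<Phi> \<beta> w \<in> U}"
    by (rule openin_continuous_map_preimage[OF continuous_map_\<Phi>[OF \<beta>]])
  then obtain T where T: "open T" "{w \<in> good. \<Phi> \<beta> w \<in> U} = good \<inter> T"
    by (auto simp: openin_open)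
  \<comment> \<open>Off \<open>good\<close> the map has the constant value \<open>M\<close>, so that
    part of the preimage is empty or the whole complement of \<open>good\<close>.\<close>
  have "w \<in> \<Phi> \<beta> -` U \<longleftrightarrow> w \<in> (good \<inter> T) \<union> (if M \<in> U then - good else {})" for w
  proof (cases "w \<in> good")
    case True
    then have "\<Phi> \<beta> w \<in> U \<longleftrightarrow> w \<in> T" using T(2) by blast
    then show ?thesis using True by simp
  qed (simp add: \<Phi>_def)
  then have "\<Phi> \<beta> -` U = (good \<inter> T) \<union> (if M \<in> U then - good else {})" by blast
  moreover have "good \<inter> T \<in> sets borel" using good_borel T(1) by (intro sets.Int) auto
  moreover have "- good \<in> sets borel" using good_borel by (rule borel_comp)
  ultimately show "\<Phi> \<beta> -` U \<inter> space row_measure \<in> sets row_measure"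
    by (auto simp: sets_row_measure)
qed (simp add: \<Phi>_in_Str)

text \<open>The bijection \<open>\<theta> \<circ> inv g\<close> is compatible with the permuted
  data, and its inverse is \<open>g \<circ> inv \<theta>\<close>.\<close>

lemma \<Phi>_permute:
  assumes \<beta>: "inj_on \<beta> B" and g: "bij g" and \<beta>': "\<And>b. b \<in> B \<Longrightarrow> \<beta>' b = g (\<beta> b)" and w: "w \<in> good"
  shows "\<Phi> \<beta>' (permute_rows g w) = logic_action L g (\<Phi> \<beta> w)"
proof -
  have inj: "inj_on \<beta>' B" using \<beta> \<beta>' g by (auto simp: inj_on_def bij_def)
  obtain \<theta> where \<theta>: "compat \<beta> w \<theta>" using ex_compat[OF \<beta> w] by blast
  then have "bij \<theta>" by (simp add: compat_def)
  then have "inv (\<theta> \<circ> inv g) = g \<circ> inv \<theta>"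
    using g by (simp add: o_inv_distrib bij_imp_bij_inv inv_inv_eq)
  moreover have "compat \<beta>' (permute_rows g w) (\<theta> \<circ> inv g)"
    unfolding permute_rows_def by (rule compat_permute[OF \<beta> \<theta> g \<beta>'])
  ultimately show ?thesis
    using \<Phi>_eq[OF inj permute_rows_good[OF g w]] \<Phi>_eq[OF \<beta> w \<theta>] g \<open>bij \<theta>\<close>
    by (simp add: logic_action_comp bij_imp_bij_inv)
qed

section \<open>Laws of the random copy and their mixture\<close>

definition \<mu> :: "(nat \<Rightarrow> nat) \<Rightarrow> ('r, 'f) struct measure" where
  "\<mu> \<beta> = distr row_measure (borel_Str L) (\<Phi> \<beta>)"

lemma prob_space_\<mu>: "inj_on \<beta> B \<Longrightarrow> prob_space (\<mu> \<beta>)"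
  unfolding \<mu>_def by (rule prob_space.prob_space_distr[OF prob_space_row_measure measurable_\<Phi>])

text \<open>Invariance of the row measure turns \<open>\<Phi>_permute\<close>, which holds almost
  surely, into an identity of laws: acting by \<open>g\<close> changes a law only through the
  placement of \<open>B\<close>.\<close>

lemma \<mu>_permute:
  assumes \<beta>: "inj_on \<beta> B" and g: "bij g" and \<beta>': "\<And>b. b \<in> B \<Longrightarrow> \<beta>' b = g (\<beta> b)"
  shows "\<mu> \<beta>' = distr (\<mu> \<beta>) (borel_Str L) (logic_action L g)"
proof -
  have inj: "inj_on \<beta>' B" using \<beta> \<beta>' g by (auto simp: inj_on_def bij_def)
  note meas = measurable_\<Phi>[OF inj] distr_permute_rows(1)[OF g] measurable_\<Phi>[OF \<beta>] measurable_logic_action[of L g]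
  have "\<mu> \<beta>' = distr (distr row_measure row_measure (permute_rows g)) (borel_Str L) (\<Phi> \<beta>')"
    by (simp add: \<mu>_def distr_permute_rows(2)[OF g])
  also have "\<dots> = distr row_measure (borel_Str L) (\<Phi> \<beta>' \<circ> permute_rows g)"
    by (rule distr_distr[OF meas(1,2)])
  also have "\<dots> = distr row_measure (borel_Str L) (logic_action L g \<circ> \<Phi> \<beta>)"
  proof (rule distr_cong_AE)
    show "AE w in row_measure. (\<Phi> \<beta>' \<circ> permute_rows g) w = (logic_action L g \<circ> \<Phi> \<beta>) w"
      using AE_good by eventually_elim (simp add: \<Phi>_permute[OF \<beta> g \<beta>'])
  qed (simp_all add: measurable_comp[OF meas(2,1)] measurable_comp[OF meas(3,4)])
  also have "\<dots> = distr (\<mu> \<beta>) (borel_Str L) (logic_action L g)"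
    unfolding \<mu>_def by (rule distr_distr[OF meas(4,3), symmetric])
  finally show ?thesis .
qed

lemma \<mu>_isomorphic:
  assumes \<beta>: "inj_on \<beta> B"
  shows "\<exists>C\<in>sets (borel_Str L). (\<forall>N\<in>C. isomorphic L M N) \<and> emeasure (\<mu> \<beta>) (Str L - C) = 0"
proof -
  interpret R: prob_space row_measure by (rule prob_space_row_measure)
  obtain K where K: "\<And>n::nat. compact (K n)" "\<And>n. K n \<subseteq> good"
    "emeasure row_measure (\<Union>n. K n) = emeasure row_measure good"
    using compact_exhaustion[OF sets_row_measure R.finite_measure_axioms good_borel] by blast
  define C where "C = (\<Union>n. \<Phi> \<beta> ` K n)"
  have "closedin (Str_topology L) (\<Phi> \<beta> ` K n)" for n
  proof (rule compactin_imp_closedin[OF Hausdorff_Str_topology])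
    have "compactin (top_of_set good) (K n)" using K by (simp add: compactin_subtopology)
    then show "compactin (Str_topology L) (\<Phi> \<beta> ` K n)"
      by (rule image_compactin[OF _ continuous_map_\<Phi>[OF \<beta>]])
  qed
  then have C: "C \<in> sets (borel_Str L)"
    unfolding C_def by (intro sets.countable_UN) (auto simp: closedin_in_borel_Str)
  have "isomorphic L M N" if "N \<in> C" for N
  proof -
    obtain w where w: "w \<in> good" "N = \<Phi> \<beta> w" using \<open>N \<in> C\<close> K(2) by (auto simp: C_def)
    obtain \<theta> where \<theta>: "compat \<beta> w \<theta>" using ex_compat[OF \<beta> w(1)] by blast
    then have "bij (inv \<theta>)" by (simp add: compat_def bij_imp_bij_inv)
    then show ?thesis
      unfolding w(2) \<Phi>_eq[OF \<beta> w(1) \<theta>] isomorphic_def using isomorphism_logic_action by blast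
  qed
  moreover have "emeasure (\<mu> \<beta>) (Str L - C) = 0"
  proof -
    have pre: "\<Phi> \<beta> -` C \<in> sets row_measure"
      using measurable_sets[OF measurable_\<Phi>[OF \<beta>] C] by simp
    have "emeasure row_measure good = 1"
      using AE_good good_borel by (simp add: R.emeasure_eq_1_AE sets_row_measure)
    \<comment> \<open>The preimage of \<open>C\<close> contains all the compact sets
      \<open>K n\<close>, whose union has the measure of \<open>good\<close>.\<close>
    then have "1 \<le> emeasure row_measure (\<Phi> \<beta> -` C)"
      using K(3) emeasure_mono[OF _ pre, of "\<Union>n. K n"] by (auto simp: C_def)
    then have "emeasure (\<mu> \<beta>) C = 1"
      unfolding \<mu>_def emeasure_distr[OF measurable_\<Phi>[OF \<beta>] C]
      by (intro antisym) (simp_all add: R.emeasure_le_1)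
    moreover interpret prob_space "\<mu> \<beta>" by (rule prob_space_\<mu>[OF \<beta>])
    have "space (\<mu> \<beta>) = Str L" by (simp add: \<mu>_def space_borel_Str)
    ultimately show ?thesis
      using emeasure_compl[of C "\<mu> \<beta>"] C emeasure_space_1 by (simp add: \<mu>_def)
  qed
  ultimately show ?thesis using C by blast
qed

text \<open>Extensionality makes a placement depend on its values on the finite set \<open>B\<close>
  alone, so that there are only countably many.\<close>

definition placements :: "(nat \<Rightarrow> nat) set" where
  "placements = {\<beta> \<in> B \<rightarrow>\<^sub>E UNIV. inj_on \<beta> B}"

lemma range_placements: "range (from_nat_into placements) = placements"
proof (rule range_from_nat_into)
  show "countable placements"
    unfolding placements_def by (rule countable_subset[OF _ countable_PiE[OF finite_B]]) auto
  have "restrict id B \<in> placements" by (simp add: placements_def)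
  then show "placements \<noteq> {}" by blast
qed

text \<open>The enumeration may repeat a placement, for instance when \<open>B\<close> is empty;
  each one still receives positive weight from the geometric law.\<close>

definition mixture :: "('r, 'f) struct measure" where
  "mixture = measure_pmf (geometric_pmf (1/2)) \<bind> (\<lambda>n. \<mu> (from_nat_into placements n))"

lemma inj_on_placement: "inj_on (from_nat_into placements n) B"
  using range_placements by (auto simp: placements_def)

lemma kernel:
  "(\<lambda>n. \<mu> (from_nat_into placements n)) \<in>
     measure_pmf (geometric_pmf (1/2)) \<rightarrow>\<^sub>M subprob_algebra (borel_Str L)"
  using prob_space_\<mu>[OF inj_on_placement]
  by (simp add: space_subprob_algebra prob_space_imp_subprob_space \<mu>_def)

lemma prob_space_mixture: "prob_space mixture"
  unfolding mixture_def
  by (rule prob_space.prob_space_bind[OF prob_space_measure_pmf _ kernel])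
    (simp add: prob_space_\<mu> inj_on_placement)

lemma sets_mixture: "sets mixture = sets (borel_Str L)"
  unfolding mixture_def by (rule sets_bind) (simp_all add: \<mu>_def)

text \<open>Every weight is positive, and an integral of nonnegative terms against such weights
  vanishes only if all terms do.\<close>

lemma null_sets_mixture:
  "X \<in> null_sets mixture \<longleftrightarrow> X \<in> sets (borel_Str L) \<and> (\<forall>\<beta>\<in>placements. emeasure (\<mu> \<beta>) X = 0)"
proof -
  let ?q = "geometric_pmf (1/2)"
  have "emeasure mixture X = 0 \<longleftrightarrow> (\<forall>\<beta>\<in>placements. emeasure (\<mu> \<beta>) X = 0)"
    if X: "X \<in> sets (borel_Str L)"
  proof -
    have "emeasure mixture X = (\<integral>\<^sup>+n. emeasure (\<mu> (from_nat_into placements n)) X \<partial>?q)"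
      unfolding mixture_def by (rule emeasure_bind[OF _ kernel X]) simp
    then have "emeasure mixture X = 0 \<longleftrightarrow> (\<forall>n\<in>set_pmf ?q. emeasure (\<mu> (from_nat_into placements n)) X = 0)"
      by (simp add: nn_integral_0_iff_AE AE_measure_pmf_iff)
    also have "\<dots> \<longleftrightarrow> (\<forall>\<beta>\<in>range (from_nat_into placements). emeasure (\<mu> \<beta>) X = 0)"
      by (simp add: set_pmf_geometric)
    finally show ?thesis by (simp only: range_placements)
  qed
  then show ?thesis by (auto simp: null_sets_def sets_mixture)
qed

text \<open>The measure of the image at the placement \<open>\<beta>'\<close> equals that of
  \<open>X\<close> at the placement moved back by \<open>inv g\<close>, and \<open>X\<close> is null
  for every placement.\<close>

lemma logic_action_null_sets:
  assumes g: "bij g" and X: "X \<in> null_sets mixture"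
  shows "logic_action L g ` X \<in> null_sets mixture"
proof -
  have X': "X \<in> sets (borel_Str L)" "X \<subseteq> Str L"
    using X sets.sets_into_space[of X "borel_Str L"] by (auto simp: null_sets_mixture space_borel_Str)
  have "bij (inv g)" using g by (rule bij_imp_bij_inv)
  have inv: "logic_action L (inv g) (logic_action L g N) = N" "logic_action L g (logic_action L (inv g) N) = N"
    if "N \<in> Str L" for N
    using logic_action_inv[OF g that] .
  \<comment> \<open>Images under \<open>g\<close> are preimages under \<open>inv g\<close>, hence
    measurable.\<close>
  have "logic_action L g ` X = logic_action L (inv g) -` X \<inter> space (borel_Str L)"
  proof (intro equalityI subsetI)
    fix N assume "N \<in> logic_action L g ` X"
    then show "N \<in> logic_action L (inv g) -` X \<inter> space (borel_Str L)"
      using inv(1) X'(2) by (auto simp: space_borel_Str logic_action_in_Str subset_iff)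
  next
    fix N assume "N \<in> logic_action L (inv g) -` X \<inter> space (borel_Str L)"
    then show "N \<in> logic_action L g ` X"
      using inv(2)[of N] by (auto simp: space_borel_Str image_iff intro!: bexI[of _ "logic_action L (inv g) N"])
  qed
  then have gX: "logic_action L g ` X \<in> sets (borel_Str L)"
    using measurable_sets[OF measurable_logic_action X'(1)] by simp
  have pre: "logic_action L g -` (logic_action L g ` X) \<inter> Str L = X"
    using inv(1) X'(2) by (auto simp: image_iff) (metis subsetD)
  have "emeasure (\<mu> \<beta>') (logic_action L g ` X) = 0" if \<beta>': "\<beta>' \<in> placements" for \<beta>'
  proof -
    \<comment> \<open>Restricting to \<open>B\<close> makes this an extensional placement;
      \<open>\<mu>_permute\<close> looks only at values on \<open>B\<close>.\<close>
    define \<beta> where "\<beta> = restrict (inv g \<circ> \<beta>') B"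
    have "inj_on (inv g \<circ> \<beta>') B"
      using \<beta>' \<open>bij (inv g)\<close> by (intro comp_inj_on) (auto simp: placements_def bij_def intro: inj_on_subset)
    then have \<beta>: "inj_on \<beta> B" "\<beta> \<in> placements" by (simp_all add: \<beta>_def placements_def)
    have "\<beta>' b = g (\<beta> b)" if "b \<in> B" for b using that g by (simp add: \<beta>_def bij_def surj_f_inv_f)
    from \<mu>_permute[OF \<beta>(1) g this]
    have "emeasure (\<mu> \<beta>') (logic_action L g ` X) = emeasure (\<mu> \<beta>) (logic_action L g -` (logic_action L g ` X) \<inter> space (\<mu> \<beta>))"
      using gX measurable_logic_action[of L g] by (simp add: emeasure_distr \<mu>_def)
    also have "\<dots> = emeasure (\<mu> \<beta>) X" using pre by (simp add: \<mu>_def space_borel_Str)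
    finally show ?thesis using X \<beta>(2) by (simp add: null_sets_mixture)
  qed
  then show ?thesis using gX by (simp add: null_sets_mixture)
qed

lemma quasi_invariant_mixture: "quasi_invariant L mixture"
  unfolding quasi_invariant_def
proof (intro allI impI ballI)
  fix g :: "nat \<Rightarrow> nat" and X assume g: "bij g" and X: "X \<in> sets mixture"
  \<comment> \<open>The converse direction is the forward one for \<open>inv g\<close>.\<close>
  have "X \<in> null_sets mixture" if "logic_action L g ` X \<in> null_sets mixture"
  proof -
    have "N \<in> Str L" if "N \<in> X" for N
      using that X sets.sets_into_space[of X "borel_Str L"] by (auto simp: sets_mixture space_borel_Str)
    then have "logic_action L (inv g) (logic_action L g N) = N" if "N \<in> X" for N
      using that by (intro logic_action_inv(1)[OF g])
    then have "logic_action L (inv g) ` logic_action L g ` X = X" by (simp add: image_image)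
    then show ?thesis
      using logic_action_null_sets[OF bij_imp_bij_inv[OF g] that] by simp
  qed
  then show "X \<in> null_sets mixture \<longleftrightarrow> logic_action L g ` X \<in> null_sets mixture"
    using logic_action_null_sets[OF g] by blast
qed

lemma AE_mixture_isomorphic: "AE N in mixture. isomorphic L M N"
proof -
  have "\<exists>C. C \<in> sets (borel_Str L) \<and> (\<forall>N\<in>C. isomorphic L M N) \<and>
    emeasure (\<mu> (from_nat_into placements n)) (Str L - C) = 0" for n
    using \<mu>_isomorphic[OF inj_on_placement] by blast
  then obtain C where C: "\<And>n. C n \<in> sets (borel_Str L)" "\<And>n N. N \<in> C n \<Longrightarrow> isomorphic L M N"
    "\<And>n. emeasure (\<mu> (from_nat_into placements n)) (Str L - C n) = 0" by metis
  \<comment> \<open>One set has to serve all placements at once: the union is Borel, still consists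
    of copies of \<open>M\<close>, and has a complement that is null for each law.\<close>
  define U where "U = (\<Union>n. C n)"
  have compl: "Str L - V \<in> sets (borel_Str L)" if "V \<in> sets (borel_Str L)" for V
    using sets.compl_sets[OF that] by (simp add: space_borel_Str)
  have U: "U \<in> sets (borel_Str L)" unfolding U_def by (intro sets.countable_UN) (auto simp: C)
  have "emeasure (\<mu> (from_nat_into placements n)) (Str L - U) = 0" for n
  proof -
    have "emeasure (\<mu> (from_nat_into placements n)) (Str L - U) \<le> emeasure (\<mu> (from_nat_into placements n)) (Str L - C n)"
      by (rule emeasure_mono) (auto simp: U_def \<mu>_def compl C(1))
    then show ?thesis using C(3)[of n] by simp
  qed
  then have "\<forall>\<beta>\<in>range (from_nat_into placements). emeasure (\<mu> \<beta>) (Str L - U) = 0" by blast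
  then have "Str L - U \<in> null_sets mixture"
    by (simp only: range_placements null_sets_mixture compl[OF U] simp_thms)
  then show ?thesis
  proof (rule AE_I')
    have "space mixture = Str L" using sets_eq_imp_space_eq[OF sets_mixture] by (simp add: space_borel_Str)
    then show "{N \<in> space mixture. \<not> isomorphic L M N} \<subseteq> Str L - U" using C(2) by (auto simp: U_def)
  qed
qed

end

theorem theorem4p1:
  fixes L :: "('r, 'f) language" and M :: "('r, 'f) struct"
  assumes "countable_language L"
    and "M \<in> Str L"
    and "\<exists>B. finite B \<and> (\<forall>a. acl L a M \<subseteq> set a \<union> B)"
  shows "\<exists>\<mu>. prob_space \<mu> \<and> sets \<mu> = sets (borel_Str L) \<and> quasi_invariant L \<mu> \<and>
           (AE N in \<mu>. isomorphic L M N)"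
proof -
  obtain B where B: "finite B" "\<And>a. acl L a M \<subseteq> set a \<union> B" using assms(3) by blast
  interpret stabilizer_group "pointwise_stabilizer (Aut L M) B" B
    by (rule stabilizer_group_Aut[OF B])
  obtain F d e where "label_tree_axioms (pointwise_stabilizer (Aut L M) B) B F d e"
    by (rule ex_tree) (rule that, unfold_locales)
  then interpret structure_tree "pointwise_stabilizer (Aut L M) B" B F d e L M
    using assms(2) B(2)
    by (intro structure_tree.intro structure_tree_axioms.intro label_tree.intro stabilizer_group_axioms) auto
  show ?thesis
    using prob_space_mixture sets_mixture quasi_invariant_mixture AE_mixture_isomorphic by blast
qed

end
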